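(* Let $\mathfrak g$ be a simple Lie algebra of rank $p$ with set of simple roots $\Pi$. Then $$\#\mathfrak{Ad}(\mathfrak g)_0=\sum_{J\subset\Pi}(-1)^{p-\#J}\,\#\mathfrak{Ad}(\mathfrak g(J)),$$ and, for every $i\in\{0,1,\dots,p\}$, $$\#\mathfrak{Ad}(\mathfrak g)_i=\sum_{J\subset\Pi,\ \#J=p-i}\#\mathfrak{Ad}(\mathfrak g(J))_0 .$$
   Context: For a semisimple Lie algebra $\mathfrak h$ with root system $\Delta$, positive roots $\Delta^+$ and simple roots $\Pi$, an $\mathsf{ad}$-nilpotent ideal is a subset $I\subset\Delta^+$ such that $\gamma\in I$, $\nu\in\Delta^+$, $\gamma+\nu\in\Delta$ imply $\gamma+\nu\in I$ (these are the sets of roots of the ideals of the Borel subalgebra $\mathfrak b$ contained in $[\mathfrak b,\mathfrak b]$). $\mathfrak{Ad}(\mathfrak h)$ is the set of all of them, and $\mathfrak{Ad}(\mathfrak h)_i=\{I\in\mathfrak{Ad}(\mathfrak h)\mid\#(I\cap\Pi)=i\}$. For $J\subset\Pi$, $\mathfrak g(J)$ is the semisimple subalgebra of $\mathfrak g$ whose set of simple roots is $J$; its positive roots are the elements of $\Delta^+$ lying in the span of $J$. For $J=\varnothing$ the only ideal is the empty one, so $\#\mathfrak{Ad}(\mathfrak g(\varnothing))=\#\mathfrak{Ad}(\mathfrak g(\varnothing))_0=1$. *)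

theory Defs
  imports Complex_Main "HOL-Library.Function_Algebras"
begin

section \<open>Simple complex Lie algebras and Cartan subalgebras\<close>

locale lie_algebra = vector_space scale
  for scale :: "complex \<Rightarrow> 'g::ab_group_add \<Rightarrow> 'g" +
  fixes br :: "'g \<Rightarrow> 'g \<Rightarrow> 'g"
  assumes br_add_left: "br (x + y) z = br x z + br y z"
    and br_add_right: "br x (y + z) = br x y + br x z"
    and br_scale_left: "br (scale c x) y = scale c (br x y)"
    and br_scale_right: "br x (scale c y) = scale c (br x y)"
    and br_self: "br x x = 0"
    and jacobi: "br x (br y z) + br y (br z x) + br z (br x y) = 0"
begin

definition lie_ideal :: "'g set \<Rightarrow> bool" where
  "lie_ideal \<aa> \<longleftrightarrow> subspace \<aa> \<and> (\<forall>x. \<forall>y\<in>\<aa>. br x y \<in> \<aa>)"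

definition ad_diagonalizable :: "'g \<Rightarrow> bool" where
  "ad_diagonalizable h \<longleftrightarrow> span {x. \<exists>c. br h x = scale c x} = UNIV"

text \<open>The usual definition for semisimple complex Lie algebras: an abelian subalgebra of
  ad-diagonalizable elements that is its own centralizer.\<close>

definition cartan_subalgebra :: "'g set \<Rightarrow> bool" where
  "cartan_subalgebra H \<longleftrightarrow> subspace H \<and>
     (\<forall>h\<in>H. \<forall>k\<in>H. br h k = 0) \<and>
     (\<forall>x. (\<forall>h\<in>H. br h x = 0) \<longrightarrow> x \<in> H) \<and>
     (\<forall>h\<in>H. ad_diagonalizable h)"

end

locale simple_lie_algebra = lie_algebra +
  assumes finite_dim: "\<exists>B. finite B \<and> span B = UNIV"
    and non_abelian: "\<exists>x y. br x y \<noteq> 0"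
    and ideals_trivial: "lie_ideal \<aa> \<Longrightarrow> \<aa> = {0} \<or> \<aa> = UNIV"


section \<open>Roots, simple roots, positive roots\<close>

definition fscale :: "complex \<Rightarrow> ('g \<Rightarrow> complex) \<Rightarrow> 'g \<Rightarrow> complex" where
  "fscale c f = (\<lambda>x. c * f x)"

interpretation functionals: vector_space fscale
  by standard (auto simp: fscale_def fun_eq_iff algebra_simps)

context lie_algebra
begin

text \<open>A linear functional on \<open>H\<close> is encoded as a function on the whole Lie algebra that
  vanishes outside \<open>H\<close>, so that equal functionals are equal functions.\<close>

definition dual_space :: "'g set \<Rightarrow> ('g \<Rightarrow> complex) set" where
  "dual_space H = {f. (\<forall>x\<in>H. \<forall>y\<in>H. f (x + y) = f x + f y) \<and>
                      (\<forall>c. \<forall>x\<in>H. f (scale c x) = c * f x) \<and>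
                      (\<forall>x. x \<notin> H \<longrightarrow> f x = 0)}"

definition root_space :: "'g set \<Rightarrow> ('g \<Rightarrow> complex) \<Rightarrow> 'g set" where
  "root_space H \<alpha> = {x. \<forall>h\<in>H. br h x = scale (\<alpha> h) x}"

definition roots :: "'g set \<Rightarrow> ('g \<Rightarrow> complex) set" where
  "roots H = {\<alpha> \<in> dual_space H. \<alpha> \<noteq> 0 \<and> root_space H \<alpha> \<noteq> {0}}"

text \<open>A set of simple roots (a base of the root system): a basis of the dual of \<open>H\<close>,
  consisting of roots, in which every root has integral coordinates of one sign.\<close>

definition simple_roots :: "'g set \<Rightarrow> ('g \<Rightarrow> complex) set \<Rightarrow> bool" where
  "simple_roots H \<Pi> \<longleftrightarrow> \<Pi> \<subseteq> roots H \<and>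
     functionals.independent \<Pi> \<and> functionals.span \<Pi> = dual_space H \<and>
     (\<forall>\<gamma>\<in>roots H. \<exists>m :: _ \<Rightarrow> int.
        \<gamma> = (\<Sum>\<alpha>\<in>\<Pi>. fscale (of_int (m \<alpha>)) \<alpha>) \<and>
        ((\<forall>\<alpha>\<in>\<Pi>. m \<alpha> \<ge> 0) \<or> (\<forall>\<alpha>\<in>\<Pi>. m \<alpha> \<le> 0)))"

definition positive_roots :: "'g set \<Rightarrow> ('g \<Rightarrow> complex) set \<Rightarrow> ('g \<Rightarrow> complex) set" where
  "positive_roots H \<Pi> =
     {\<gamma> \<in> roots H. \<exists>m :: _ \<Rightarrow> nat. \<gamma> = (\<Sum>\<alpha>\<in>\<Pi>. fscale (of_nat (m \<alpha>)) \<alpha>)}"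

end


section \<open>Ad-nilpotent ideals\<close>

text \<open>Here \<open>\<Delta>\<close> is a root system, \<open>\<Delta>p\<close> its positive roots and \<open>\<Pi>\<close> its simple roots.\<close>

definition Ad :: "'v::plus set \<Rightarrow> 'v set \<Rightarrow> 'v set set" where
  "Ad \<Delta> \<Delta>p = {I. I \<subseteq> \<Delta>p \<and> (\<forall>\<gamma>\<in>I. \<forall>\<nu>\<in>\<Delta>p. \<gamma> + \<nu> \<in> \<Delta> \<longrightarrow> \<gamma> + \<nu> \<in> I)}"

definition Ad_level :: "'v::plus set \<Rightarrow> 'v set \<Rightarrow> 'v set \<Rightarrow> nat \<Rightarrow> 'v set set" where
  "Ad_level \<Delta> \<Delta>p \<Pi> i = {I \<in> Ad \<Delta> \<Delta>p. card (I \<inter> \<Pi>) = i}"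

context lie_algebra
begin

definition Ad_g :: "'g set \<Rightarrow> ('g \<Rightarrow> complex) set \<Rightarrow> ('g \<Rightarrow> complex) set set" where
  "Ad_g H \<Pi> = Ad (roots H) (positive_roots H \<Pi>)"

definition Ad_g_level :: "'g set \<Rightarrow> ('g \<Rightarrow> complex) set \<Rightarrow> nat \<Rightarrow> ('g \<Rightarrow> complex) set set" where
  "Ad_g_level H \<Pi> i = Ad_level (roots H) (positive_roots H \<Pi>) \<Pi> i"

text \<open>For \<open>J \<subseteq> \<Pi>\<close>, the semisimple subalgebra with simple roots \<open>J\<close> has as its
  (positive) roots the (positive) roots lying in the span of \<open>J\<close>.\<close>

definition sub_roots :: "'g set \<Rightarrow> ('g \<Rightarrow> complex) set \<Rightarrow> ('g \<Rightarrow> complex) set" where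
  "sub_roots H J = roots H \<inter> functionals.span J"

definition sub_positive_roots ::
    "'g set \<Rightarrow> ('g \<Rightarrow> complex) set \<Rightarrow> ('g \<Rightarrow> complex) set \<Rightarrow> ('g \<Rightarrow> complex) set" where
  "sub_positive_roots H \<Pi> J = positive_roots H \<Pi> \<inter> functionals.span J"

definition Ad_sub ::
    "'g set \<Rightarrow> ('g \<Rightarrow> complex) set \<Rightarrow> ('g \<Rightarrow> complex) set \<Rightarrow> ('g \<Rightarrow> complex) set set" where
  "Ad_sub H \<Pi> J = Ad (sub_roots H J) (sub_positive_roots H \<Pi> J)"

definition Ad_sub_level ::
    "'g set \<Rightarrow> ('g \<Rightarrow> complex) set \<Rightarrow> ('g \<Rightarrow> complex) set \<Rightarrow> nat \<Rightarrow> ('g \<Rightarrow> complex) set set" where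
  "Ad_sub_level H \<Pi> J i = Ad_level (sub_roots H J) (sub_positive_roots H \<Pi> J) J i"

lemma Ad_sub_empty: "Ad_sub H \<Pi> {} = {{}}"
  by (auto simp: Ad_sub_def Ad_def sub_positive_roots_def positive_roots_def roots_def)

lemma Ad_sub_level_empty: "Ad_sub_level H \<Pi> {} 0 = {{}}"
  using Ad_sub_empty[of H \<Pi>] by (auto simp: Ad_sub_level_def Ad_level_def Ad_sub_def)

end

end

(* The whole theorem rests on one fact about roots: a positive root that is not simple is the sum
   of a positive root and a simple root. It implies that an ideal containing the simple root \<alpha>
   contains every positive root with \<alpha> in its support. Hence, for J \<subseteq> \<Pi>, intersection with the
   span of J is a bijection from the ideals I of g with \<Pi> - J \<subseteq> I onto the ideals of g(J); the two
   formulas then follow by inclusion-exclusion and by sorting the ideals according to I \<inter> \<Pi>.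

   The fact about roots needs a nondegenerate Killing form but not Cartan's criterion: roots take
   integral values on the basis of H dual to \<Pi>, so the form is visibly positive definite on the
   real span of that basis; it is therefore nonzero, and nondegenerate because its radical is an
   ideal. If \<gamma> is a positive root, some simple \<alpha> has (\<gamma>, \<alpha>) > 0, and then \<gamma> - \<alpha> is a root or zero,
   since otherwise all \<gamma> + k \<alpha> would be roots. *)

theory Submission
  imports Defs
begin

section \<open>Bracket and simultaneous diagonalization\<close>

context lie_algebra
begin

section \<open>Elementary bracket identities\<close>

lemma br_zero_left [simp]: "br 0 y = 0"
  using br_scale_left[of 0 0 y] by simp

lemma br_zero_right [simp]: "br x 0 = 0"
  using br_scale_right[of x 0 0] by simp

lemma br_skew: "br y x = - br x y"
proof -
  have "br (x + y) (x + y) = br x y + br y x"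
    unfolding br_add_left br_add_right by (simp add: br_self)
  then show ?thesis
    by (simp add: br_self eq_neg_iff_add_eq_0 add.commute)
qed

lemma br_minus_right: "br x (- y) = - br x y"
  using br_scale_right[of x "- 1" y] by simp

lemma br_diff_right: "br x (y - z) = br x y - br x z"
  using br_add_right[of x y "- z"] by (simp add: br_minus_right)

lemma br_sum_right: "br x (sum f A) = (\<Sum>a\<in>A. br x (f a))"
  by (induction A rule: infinite_finite_induct) (simp_all add: br_add_right)

lemma br_derivation: "br x (br y z) = br (br x y) z + br y (br x z)"
proof -
  have "br y (br z x) = - br y (br x z)" "br z (br x y) = - br (br x y) z"
    using br_skew[of x z] br_skew[of "br x y" z] by (simp_all add: br_minus_right)
  with jacobi[of x y z] show ?thesis
    by (simp add: algebra_simps add_eq_0_iff)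
qed

lemma linear_br: "Vector_Spaces.linear scale scale (br x)"
  by unfold_locales (simp_all add: br_add_right br_scale_right)

section \<open>Eigenvectors and simultaneous diagonalization\<close>

text \<open>Applying \<open>br h\<close> minus d times the identity to the relation removes the term
  of eigenvalue d and multiplies every other term by the nonzero factor c - d, so induction applies.
  Indexing by the eigenvalue makes distinctness automatic and lets some \<open>w c\<close> be
  zero.\<close>

lemma eigenvectors_independent:
  assumes "finite K" "\<And>c. c \<in> K \<Longrightarrow> br h (w c) = scale c (w c)"
    and "(\<Sum>c\<in>K. w c) = 0" "c \<in> K"
  shows "w c = 0"
  using assms
proof (induction K arbitrary: w c rule: finite_induct)
  case empty
  then show ?case by simp
next
  case (insert d K)
  have *: "scale (e - d) (w e) = 0" if "e \<in> K" for e
  proof (rule insert.IH[of "\<lambda>e. scale (e - d) (w e)", OF _ _ that])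
    show "br h (scale (c - d) (w c)) = scale c (scale (c - d) (w c))" if "c \<in> K" for c
      using insert.prems(1)[of c] that by (simp add: br_scale_right mult.commute)
    have "(\<Sum>c\<in>K. scale (c - d) (w c)) = (\<Sum>c\<in>insert d K. scale (c - d) (w c))"
      using insert.hyps by simp
    also have "\<dots> = (\<Sum>c\<in>insert d K. br h (w c)) - (\<Sum>c\<in>insert d K. scale d (w c))"
      unfolding sum_subtractf[symmetric]
      by (intro sum.cong refl) (metis insert.prems(1) scale_left_diff_distrib)
    also have "\<dots> = 0"
      using insert.prems(2) by (simp only: br_sum_right[symmetric] scale_sum_right[symmetric]) simp
    finally show "(\<Sum>c\<in>K. scale (c - d) (w c)) = 0" .
  qed
  have K0: "w e = 0" if "e \<in> K" for e
    using *[OF that] insert.hyps that by auto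
  then have "w d = 0"
    using insert.prems(2) insert.hyps by simp
  then show ?case
    using K0 insert.prems(3) by auto
qed

lemma eigenvector_decomposition:
  assumes "ad_diagonalizable h"
  obtains K w where "finite K" "\<And>c. br h (w c) = scale c (w c)" "v = (\<Sum>c\<in>K. w c)"
proof -
  have "v \<in> span {x. \<exists>c. br h x = scale c x}"
    using assms by (simp add: ad_diagonalizable_def)
  \<comment> \<open>The extra clause that w vanishes off K carries the induction: K can be enlarged
    by a new eigenvalue c without changing the sum.\<close>
  then have "\<exists>K w. finite K \<and> (\<forall>c. br h (w c) = scale c (w c)) \<and> (\<forall>c. c \<notin> K \<longrightarrow> w c = 0)
      \<and> v = (\<Sum>c\<in>K. w c)"
  proof (induction rule: span_induct_alt)
    case base
    show ?case
      by (intro exI[of _ "{}"] exI[of _ "\<lambda>_. 0"]) auto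
  next
    case (step a x y)
    then obtain c K w where c: "br h x = scale c x" and K: "finite K"
      "\<And>c. br h (w c) = scale c (w c)" "\<And>c. c \<notin> K \<Longrightarrow> w c = 0" "y = (\<Sum>c\<in>K. w c)"
      by blast
    define w' where "w' = (\<lambda>d. (if d = c then scale a x else 0) + w d)"
    have y: "y = (\<Sum>c\<in>insert c K. w c)"
      using K by (cases "c \<in> K") (auto simp: insert_absorb)
    have "(\<Sum>d\<in>insert c K. w' d) = (\<Sum>d\<in>insert c K. if d = c then scale a x else 0) + y"
      unfolding y w'_def by (rule sum.distrib)
    also have "(\<Sum>d\<in>insert c K. if d = c then scale a x else 0) = scale a x"
      using K(1) by (simp add: sum.delta)
    finally have "scale a x + y = (\<Sum>d\<in>insert c K. w' d)" by simp
    moreover have "br h (w' d) = scale d (w' d)" for d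
      using c K(2)[of d]
      by (simp add: w'_def br_add_right br_scale_right scale_right_distrib mult.commute)
    moreover have "w' d = 0" if "d \<notin> insert c K" for d
      using that K(3) by (simp add: w'_def)
    ultimately show ?case
      using K(1) by (intro exI[of _ "insert c K"] exI[of _ w']) auto
  qed
  then show ?thesis
    using that by blast
qed

text \<open>Induction on S: a joint eigenvector for S is split into its components under
  \<open>br h\<close>, and these turn out to be joint eigenvectors for S as well.\<close>

lemma span_joint_eigenvectors:
  assumes "finite S" "\<And>h. h \<in> S \<Longrightarrow> ad_diagonalizable h"
    and "\<And>h k. h \<in> S \<Longrightarrow> k \<in> S \<Longrightarrow> br h k = 0"
  shows "span {v. \<forall>h\<in>S. \<exists>c. br h v = scale c v} = UNIV"
  using assms
proof (induction S rule: finite_induct)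
  case empty
  then show ?case by simp
next
  case (insert h S)
  let ?E = "\<lambda>S. {v. \<forall>h\<in>S. \<exists>c. br h v = scale c v}"
  have "v \<in> span (?E (insert h S))" if v: "v \<in> ?E S" for v
  proof -
    obtain K w where K: "finite K" "\<And>c. br h (w c) = scale c (w c)" "v = (\<Sum>c\<in>K. w c)"
      using eigenvector_decomposition[of h v] insert.prems(1) by blast
    have "w c \<in> ?E (insert h S)" if c: "c \<in> K" for c
    proof -
      have "\<exists>\<mu>. br k (w c) = scale \<mu> (w c)" if k: "k \<in> S" for k
      proof -
        obtain \<mu> where \<mu>: "br k v = scale \<mu> v"
          using v k by blast
        \<comment> \<open>Since \<open>br k\<close> commutes with \<open>br h\<close>, these vectors
          are again eigenvectors of \<open>br h\<close> for distinct eigenvalues. They sum to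
          \<open>br k v - scale \<mu> v = 0\<close>, so each is zero.\<close>
        have "br k (w c) - scale \<mu> (w c) = 0"
        proof (rule eigenvectors_independent[of K h, OF K(1) _ _ c])
          fix d
          have "br h (br k (w d)) = br k (br h (w d))"
            using br_derivation[of h k "w d"] insert.prems(2)[of h k] k by simp
          then show "br h (br k (w d) - scale \<mu> (w d)) = scale d (br k (w d) - scale \<mu> (w d))"
            by (simp add: br_diff_right br_scale_right K(2) scale_right_diff_distrib mult.commute)
        next
          show "(\<Sum>c\<in>K. br k (w c) - scale \<mu> (w c)) = 0"
            using \<mu> unfolding K(3) by (simp add: sum_subtractf br_sum_right scale_sum_right)
        qed
        then show ?thesis by auto
      qed
      then show ?thesis
        using K(2) by auto
    qed
    then show ?thesis
      unfolding K(3) by (intro span_sum span_base)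
  qed
  then have "span (?E S) \<subseteq> span (?E (insert h S))"
    by (intro span_minimal) auto
  moreover have "span (?E S) = UNIV"
    using insert.IH insert.prems by auto
  ultimately show ?case by auto
qed

text \<open>A trace with respect to a basis \<open>B\<close>; the basis is never changed, so that its
  independence of \<open>B\<close> is not an issue.\<close>

definition trace_on :: "'g set \<Rightarrow> ('g \<Rightarrow> 'g) \<Rightarrow> complex" where
  "trace_on B f = (\<Sum>b\<in>B. representation B (f b) b)"

text \<open>Both traces are the same double sum of products of matrix entries, up to the order of
  summation.\<close>

lemma trace_on_comp_commute:
  assumes B: "finite B" "independent B" "span B = UNIV"
    and f: "Vector_Spaces.linear scale scale f" and g: "Vector_Spaces.linear scale scale g"
  shows "trace_on B (\<lambda>x. f (g x)) = trace_on B (\<lambda>x. g (f x))"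
proof -
  have *: "representation B (f (g b)) b =
      (\<Sum>c\<in>B. representation B (g b) c * representation B (f c) b)"
    if f: "Vector_Spaces.linear scale scale f" for f g b
  proof -
    interpret f: Vector_Spaces.linear scale scale f by (rule f)
    have "f (g b) = f (\<Sum>c\<in>B. scale (representation B (g b) c) c)"
      using B by (simp add: sum_representation_eq)
    also have "\<dots> = (\<Sum>c\<in>B. scale (representation B (g b) c) (f c))"
      by (simp add: f.sum f.scale)
    finally show ?thesis
      using B by (simp add: representation_sum representation_scale sum.distrib)
  qed
  have "trace_on B (\<lambda>x. f (g x)) =
      (\<Sum>b\<in>B. \<Sum>c\<in>B. representation B (g b) c * representation B (f c) b)"
    unfolding trace_on_def by (intro sum.cong refl *[OF f])
  also have "\<dots> = (\<Sum>c\<in>B. \<Sum>b\<in>B. representation B (f c) b * representation B (g b) c)"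
    by (subst sum.swap) (simp add: mult.commute)
  also have "\<dots> = trace_on B (\<lambda>x. g (f x))"
    unfolding trace_on_def by (intro sum.cong refl *[OF g, symmetric])
  finally show ?thesis .
qed

end

section \<open>Weight vectors and the Killing form\<close>

locale split_simple_lie_algebra = simple_lie_algebra scale br
  for scale :: "complex \<Rightarrow> 'g::ab_group_add \<Rightarrow> 'g" and br +
  fixes H :: "'g set"
  assumes cartan: "cartan_subalgebra H"
begin

section \<open>The Cartan subalgebra and its dual space\<close>

lemma subspace_H: "subspace H"
  and H_abelian: "h \<in> H \<Longrightarrow> k \<in> H \<Longrightarrow> br h k = 0"
  and H_self_centralizing: "(\<And>h. h \<in> H \<Longrightarrow> br h x = 0) \<Longrightarrow> x \<in> H"
  and H_diagonalizable: "h \<in> H \<Longrightarrow> ad_diagonalizable h"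
  using cartan by (auto simp: cartan_subalgebra_def)

lemma independent_imp_finite: "independent B \<Longrightarrow> finite B"
  using finite_dim independent_span_bound[of _ B] by blast

lemma cartan_basis:
  obtains C where "C \<subseteq> H" "finite C" "independent C" "span C = H"
proof -
  obtain C where C: "C \<subseteq> H" "independent C" "H \<subseteq> span C"
    using maximal_independent_subset[of H] by blast
  then have "span C = H"
    using span_subspace subspace_H by blast
  with that C independent_imp_finite show ?thesis by blast
qed

lemma dual_space_add: "f \<in> dual_space H \<Longrightarrow> g \<in> dual_space H \<Longrightarrow> f + g \<in> dual_space H"
  and dual_space_diff: "f \<in> dual_space H \<Longrightarrow> g \<in> dual_space H \<Longrightarrow> f - g \<in> dual_space H"
  and dual_space_zero: "0 \<in> dual_space H"
  and dual_space_uminus: "f \<in> dual_space H \<Longrightarrow> - f \<in> dual_space H"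
  and dual_space_fscale: "f \<in> dual_space H \<Longrightarrow> fscale c f \<in> dual_space H"
  by (auto simp: dual_space_def fscale_def algebra_simps)

lemma dual_space_eqI:
  assumes "f \<in> dual_space H" "g \<in> dual_space H" "\<And>h. h \<in> H \<Longrightarrow> f h = g h"
  shows "f = g"
proof
  fix x show "f x = g x"
    using assms by (cases "x \<in> H") (auto simp: dual_space_def)
qed

text \<open>Elements of \<open>dual_space H\<close> are linear on H only, being extended by zero;
  hence every \<open>u a\<close> must lie in H.\<close>

lemma dual_space_sum:
  assumes "f \<in> dual_space H" "\<And>a. a \<in> A \<Longrightarrow> u a \<in> H"
  shows "f (\<Sum>a\<in>A. scale (c a) (u a)) = (\<Sum>a\<in>A. c a * f (u a))"
  using assms(2)
proof (induction A rule: infinite_finite_induct)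
  case (insert a A)
  have "scale (c a) (u a) \<in> H" "(\<Sum>a\<in>A. scale (c a) (u a)) \<in> H"
    using insert.prems by (auto intro!: subspace_sum subspace_scale subspace_H)
  then show ?case
    using assms(1) insert by (simp add: dual_space_def)
qed (use assms(1) dual_space_zero subspace_0[OF subspace_H] scale_zero_left[of 0]
      in \<open>auto simp: dual_space_def\<close>, metis mult_zero_left scale_zero_left)+

lemma root_spaceD: "x \<in> root_space H \<kappa> \<Longrightarrow> h \<in> H \<Longrightarrow> br h x = scale (\<kappa> h) x"
  by (simp add: root_space_def)

lemma root_space_zero_subset: "x \<in> root_space H 0 \<Longrightarrow> x \<in> H"
  by (rule H_self_centralizing) (simp add: root_space_def)

lemma br_root_space:
  assumes "x \<in> root_space H \<kappa>" "y \<in> root_space H \<mu>"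
  shows "br x y \<in> root_space H (\<kappa> + \<mu>)"
  using assms by (auto simp: root_space_def br_derivation[of _ x y] br_scale_left br_scale_right
      scale_left_distrib)

text \<open>The weight zero is allowed, so that the vectors of H are included and the whole algebra
  is spanned.\<close>

definition weight_vectors :: "'g set" where
  "weight_vectors = {v. v \<noteq> 0 \<and> (\<exists>\<kappa>\<in>dual_space H. v \<in> root_space H \<kappa>)}"

text \<open>As v is nonzero, the eigenvalue is determined by h, and bilinearity of the bracket makes
  it linear in h.\<close>

lemma joint_eigenvector_weight:
  assumes v: "v \<noteq> 0" and eig: "\<And>h. h \<in> H \<Longrightarrow> \<exists>c. br h v = scale c v"
  shows "v \<in> weight_vectors"
proof -
  define \<kappa> where "\<kappa> h = (if h \<in> H then SOME c. br h v = scale c v else 0)" for h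
  have \<kappa>: "br h v = scale (\<kappa> h) v" if "h \<in> H" for h
    using someI_ex[OF eig[OF that]] that by (simp add: \<kappa>_def)
  have "\<kappa> (x + y) = \<kappa> x + \<kappa> y" if "x \<in> H" "y \<in> H" for x y
  proof -
    have "scale (\<kappa> (x + y)) v = scale (\<kappa> x + \<kappa> y) v"
      using \<kappa>[of "x + y"] \<kappa>[of x] \<kappa>[of y] that subspace_add[OF subspace_H]
      by (simp add: br_add_left scale_left_distrib)
    then show ?thesis using v by (simp only: scale_cancel_right) simp
  qed
  moreover have "\<kappa> (scale c x) = c * \<kappa> x" if "x \<in> H" for x c
  proof -
    have "scale (\<kappa> (scale c x)) v = scale (c * \<kappa> x) v"
      using \<kappa>[of "scale c x"] \<kappa>[of x] that subspace_scale[OF subspace_H]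
      by (auto simp: br_scale_left)
    then show ?thesis using v by (metis scale_cancel_right)
  qed
  ultimately have "\<kappa> \<in> dual_space H"
    by (auto simp: dual_space_def \<kappa>_def)
  with \<kappa> v show ?thesis
    by (auto simp: weight_vectors_def root_space_def)
qed

text \<open>Simultaneous diagonalization handles a finite commuting set, so it is applied to a basis
  of H; an eigenvector of a basis is one of all of H.\<close>

lemma span_weight_vectors: "span weight_vectors = UNIV"
proof -
  obtain C where C: "C \<subseteq> H" "finite C" "span C = H"
    by (rule cartan_basis)
  let ?E = "{v. \<forall>h\<in>C. \<exists>c. br h v = scale c v}"
  have "v \<in> span weight_vectors" if v: "v \<in> ?E" for v
  proof (cases "v = 0")
    case False
    have "\<exists>c. br h v = scale c v" if "h \<in> H" for h
    proof -
      have "h \<in> span C"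
        using that C by simp
      then show ?thesis
      proof (induction rule: span_induct_alt)
        case base
        show ?case by (intro exI[of _ 0]) simp
      next
        case (step a x y)
        then obtain c d where "br x v = scale c v" "br y v = scale d v"
          using v by blast
        then have "br (scale a x + y) v = scale (a * c + d) v"
          by (simp add: br_add_left br_scale_left scale_left_distrib)
        then show ?case ..
      qed
    qed
    then show ?thesis
      using joint_eigenvector_weight[OF False] span_base by blast
  qed (simp add: span_zero)
  then have "span ?E \<subseteq> span weight_vectors"
    by (intro span_minimal) auto
  moreover have "span ?E = UNIV"
    using C(2) subsetD[OF C(1)] H_diagonalizable H_abelian by (intro span_joint_eigenvectors) blast+
  ultimately show ?thesis by auto
qed

text \<open>Fixed once and for all: every trace is computed in this basis, in which H acts
  diagonally.\<close>

definition weight_basis :: "'g set" where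
  "weight_basis = (SOME B. B \<subseteq> weight_vectors \<and> independent B \<and> span B = UNIV)"

lemma weight_basis:
  "weight_basis \<subseteq> weight_vectors" "independent weight_basis" "span weight_basis = UNIV"
proof -
  obtain B where B: "B \<subseteq> weight_vectors" "independent B" "weight_vectors \<subseteq> span B"
    using maximal_independent_subset[of weight_vectors] by blast
  then have "span B = UNIV"
    using span_minimal[of weight_vectors "span B"] span_weight_vectors by auto
  with B have "\<exists>B. B \<subseteq> weight_vectors \<and> independent B \<and> span B = UNIV" by blast
  from someI_ex[OF this]
  show "weight_basis \<subseteq> weight_vectors" "independent weight_basis" "span weight_basis = UNIV"
    by (auto simp: weight_basis_def)
qed

lemma finite_weight_basis: "finite weight_basis"
  using weight_basis independent_imp_finite by blast

definition weight :: "'g \<Rightarrow> 'g \<Rightarrow> complex" where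
  "weight b = (SOME \<kappa>. \<kappa> \<in> dual_space H \<and> b \<in> root_space H \<kappa>)"

lemma weight:
  assumes "b \<in> weight_basis"
  shows "weight b \<in> dual_space H" "b \<in> root_space H (weight b)" "b \<noteq> 0"
proof -
  have "b \<noteq> 0" "\<exists>\<kappa>. \<kappa> \<in> dual_space H \<and> b \<in> root_space H \<kappa>"
    using assms weight_basis(1) by (auto simp: weight_vectors_def)
  from this(1) someI_ex[OF this(2)]
  show "weight b \<in> dual_space H" "b \<in> root_space H (weight b)" "b \<noteq> 0"
    by (auto simp: weight_def)
qed

lemma weight_zero_or_root: "b \<in> weight_basis \<Longrightarrow> weight b = 0 \<or> weight b \<in> roots H"
  using weight[of b] by (auto simp: roots_def)

lemma br_weight_basis: "b \<in> weight_basis \<Longrightarrow> h \<in> H \<Longrightarrow> br h b = scale (weight b h) b"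
  using weight root_spaceD by blast

lemma weight_basis_expand:
  "x = (\<Sum>b\<in>weight_basis. scale (representation weight_basis x b) b)"
  using weight_basis finite_weight_basis by (simp add: sum_representation_eq)

section \<open>Roots as weights of the basis\<close>

lemma root_dual_space: "\<alpha> \<in> roots H \<Longrightarrow> \<alpha> \<in> dual_space H"
  and root_nonzero: "\<alpha> \<in> roots H \<Longrightarrow> \<alpha> \<noteq> 0"
  by (simp_all add: roots_def)

lemma root_vector:
  assumes "\<alpha> \<in> roots H"
  obtains x where "x \<noteq> 0" "x \<in> root_space H \<alpha>"
  using assms by (auto simp: roots_def root_space_def)

lemma rootI:
  assumes "\<alpha> \<in> dual_space H" "\<alpha> \<noteq> 0" "x \<in> root_space H \<alpha>" "x \<noteq> 0"
  shows "\<alpha> \<in> roots H"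
  using assms by (auto simp: roots_def)

text \<open>Comparing the coefficients at b of both sides of
  \<open>br h x = scale (\<alpha> h) x\<close>, for a b that occurs in the root vector x, gives
  \<alpha> = \<open>weight b\<close>. Hence there are finitely many roots.\<close>

lemma root_is_weight:
  assumes \<alpha>: "\<alpha> \<in> roots H"
  shows "\<alpha> \<in> weight ` weight_basis"
proof -
  let ?r = "representation weight_basis"
  obtain x where x: "x \<noteq> 0" "x \<in> root_space H \<alpha>"
    using root_vector[OF \<alpha>] .
  then obtain b where b: "b \<in> weight_basis" "?r x b \<noteq> 0"
    using weight_basis_expand[of x] by (metis (no_types, lifting) scale_zero_left sum.neutral)
  have "\<alpha> = weight b"
  proof (rule dual_space_eqI)
    fix h assume h: "h \<in> H"
    have "br h x = (\<Sum>c\<in>weight_basis. scale (?r x c) (br h c))"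
      by (subst weight_basis_expand[of x]) (simp add: br_sum_right br_scale_right)
    also have "\<dots> = (\<Sum>c\<in>weight_basis. scale (?r x c * weight c h) c)"
      by (intro sum.cong refl) (simp add: br_weight_basis h)
    finally have "?r (br h x) b = (\<Sum>c\<in>weight_basis. ?r (scale (?r x c * weight c h) c) b)"
      using weight_basis by (simp add: representation_sum)
    also have "\<dots> = (\<Sum>c\<in>weight_basis. if c = b then ?r x b * weight b h else 0)"
      using weight_basis
      by (intro sum.cong refl) (auto simp: representation_scale representation_basis)
    finally have "?r (br h x) b = ?r x b * weight b h"
      using finite_weight_basis b by (simp add: sum.delta)
    moreover have "?r (br h x) b = \<alpha> h * ?r x b"
      using weight_basis root_spaceD[OF x(2) h] by (simp add: representation_scale)
    ultimately show "\<alpha> h = weight b h"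
      using b by simp
  qed (use weight b \<alpha> root_dual_space in auto)
  then show ?thesis using b by blast
qed

lemma finite_roots: "finite (roots H)"
  using root_is_weight finite_weight_basis by (meson finite_imageI finite_subset subsetI)

section \<open>The Killing form\<close>

definition killing :: "'g \<Rightarrow> 'g \<Rightarrow> complex" where
  "killing x y = trace_on weight_basis (\<lambda>z. br x (br y z))"

lemma killing_add_left: "killing (x + x') y = killing x y + killing x' y"
  and killing_add_right: "killing x (y + y') = killing x y + killing x y'"
  and killing_scale_left: "killing (scale c x) y = c * killing x y"
  and killing_scale_right: "killing x (scale c y) = c * killing x y"
  unfolding killing_def trace_on_def using weight_basis
  by (simp_all add: br_add_left br_add_right br_scale_left br_scale_right representation_add
      representation_scale sum.distrib sum_distrib_left)

lemma killing_sum_right: "killing x (\<Sum>a\<in>A. scale (c a) (u a)) = (\<Sum>a\<in>A. c a * killing x (u a))"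
  using killing_scale_right[of x 0 0]
  by (induction A rule: infinite_finite_induct) (simp_all add: killing_add_right killing_scale_right)

lemma killing_commute: "killing x y = killing y x"
  unfolding killing_def
  by (rule trace_on_comp_commute) (use weight_basis finite_weight_basis linear_br in auto)

text \<open>In terms of adjoint operators X, Y, Z, the left side is tr(XYZ) - tr(YXZ); moving Y to
  the end of the second product gives tr(XYZ) - tr(XZY), the right side.\<close>

lemma killing_invariant: "killing (br x y) z = killing x (br y z)"
proof -
  let ?r = "representation weight_basis"
  let ?t = "trace_on weight_basis"
  have lin: "Vector_Spaces.linear scale scale (\<lambda>w. br y (br z w))" for y z
    using Vector_Spaces.linear_compose[OF linear_br linear_br] by (simp add: o_def)
  have diff: "?t (\<lambda>w. f w - g w) = ?t f - ?t g" for f g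
    unfolding trace_on_def using weight_basis
    by (simp add: representation_diff sum_subtractf)
  have "killing (br x y) z = ?t (\<lambda>w. br x (br y (br z w))) - ?t (\<lambda>w. br y (br x (br z w)))"
    unfolding killing_def diff[symmetric]
    by (simp add: br_derivation[of x y])
  also have "?t (\<lambda>w. br y (br x (br z w))) = ?t (\<lambda>w. br x (br z (br y w)))"
    by (rule trace_on_comp_commute[of _ "br y" "\<lambda>w. br x (br z w)"])
      (use weight_basis finite_weight_basis linear_br lin in auto)
  also have "?t (\<lambda>w. br x (br y (br z w))) - ?t (\<lambda>w. br x (br z (br y w))) = killing x (br y z)"
    unfolding killing_def diff[symmetric]
    by (simp add: br_derivation[of y z] br_diff_right[symmetric])
  finally show ?thesis .
qed

lemma killing_cartan:
  assumes "h \<in> H" "k \<in> H"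
  shows "killing h k = (\<Sum>b\<in>weight_basis. weight b h * weight b k)"
  unfolding killing_def trace_on_def
  by (intro sum.cong refl)
    (use assms weight_basis in \<open>simp add: br_weight_basis br_scale_right representation_scale
      representation_basis mult.commute\<close>)

text \<open>Invariance under h in H yields (\<kappa> h + \<mu> h) \<open>killing x y\<close> =
  0.\<close>

lemma killing_root_spaces:
  assumes "x \<in> root_space H \<kappa>" "y \<in> root_space H \<mu>" "\<kappa> \<in> dual_space H" "\<mu> \<in> dual_space H"
    and "killing x y \<noteq> 0"
  shows "\<mu> = - \<kappa>"
proof (rule dual_space_eqI)
  fix h assume h: "h \<in> H"
  have "killing (br x h) y = killing x (br h y)"
    by (rule killing_invariant)
  moreover have "br x h = scale (- \<kappa> h) x"
    using br_skew[of h x] root_spaceD[OF assms(1) h] by simp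
  ultimately have "- \<kappa> h * killing x y = \<mu> h * killing x y"
    using root_spaceD[OF assms(2) h] by (simp only: killing_scale_left killing_scale_right)
  then have "(\<kappa> h + \<mu> h) * killing x y = 0"
    by (metis add.right_inverse distrib_right mult_minus_left)
  then show "\<mu> h = (- \<kappa>) h"
    using assms(5) by (simp add: add_eq_0_iff)
qed (use assms dual_space_uminus in auto)

text \<open>Invariance makes the radical an ideal; by simplicity it is zero or everything, and one
  nonzero value of the form excludes the latter.\<close>

lemma killing_radical_trivial:
  assumes "killing u v \<noteq> 0" and "\<And>y. killing x y = 0"
  shows "x = 0"
proof -
  let ?R = "{x. \<forall>y. killing x y = 0}"
  have "lie_ideal ?R"
    unfolding lie_ideal_def
  proof safe
    show "subspace ?R"
      using killing_scale_left[of 0 0]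
      by (auto intro!: subspaceI simp: killing_add_left killing_scale_left)
  next
    fix a x y assume "\<forall>y. killing x y = 0"
    then have "killing (br x a) y = 0"
      by (simp add: killing_invariant)
    then show "killing (br a x) y = 0"
      using killing_scale_left[of "- 1" "br x a" y] by (simp add: br_skew[of x a])
  qed
  then have "?R = {0}"
    using ideals_trivial assms(1) by blast
  with assms(2) show ?thesis by blast
qed

end

section \<open>Positive roots that are not simple\<close>

lemma sum_apply: "(\<Sum>a\<in>A. f a) x = (\<Sum>a\<in>A. f a x)" for f :: "'a \<Rightarrow> 'b \<Rightarrow> 'c::comm_monoid_add"
  by (induction A rule: infinite_finite_induct) simp_all

locale based_simple_lie_algebra = split_simple_lie_algebra scale br H
  for scale :: "complex \<Rightarrow> 'g::ab_group_add \<Rightarrow> 'g" and br and H :: "'g set" +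
  fixes \<Pi> :: "('g \<Rightarrow> complex) set"
  assumes base: "simple_roots H \<Pi>"
begin

section \<open>Simple roots and the dual basis of coweights\<close>

lemma simple_subset_roots: "\<Pi> \<subseteq> roots H"
  and independent_simple: "functionals.independent \<Pi>"
  and span_simple: "functionals.span \<Pi> = dual_space H"
  using base by (auto simp: simple_roots_def)

lemma finite_simple: "finite \<Pi>"
  using simple_subset_roots finite_roots finite_subset by blast

lemma simple_dual_space: "\<alpha> \<in> \<Pi> \<Longrightarrow> \<alpha> \<in> dual_space H"
  using simple_subset_roots root_dual_space by blast

text \<open>The functional dual to the basis vector c, cut off outside H so as to be an element of
  \<open>dual_space H\<close>.\<close>

definition coordinate :: "'g set \<Rightarrow> 'g \<Rightarrow> 'g \<Rightarrow> complex" where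
  "coordinate C c = (\<lambda>x. if x \<in> H then representation C x c else 0)"

lemma coordinate_dual_space:
  assumes "independent C" "span C = H"
  shows "coordinate C c \<in> dual_space H"
  using assms subspace_add[OF subspace_H] subspace_scale[OF subspace_H]
  by (auto simp: dual_space_def coordinate_def representation_add representation_scale)

lemma coordinate_basis:
  assumes "independent C" "C \<subseteq> H" "d \<in> C"
  shows "coordinate C c d = (if c = d then 1 else 0)"
  using assms by (auto simp: coordinate_def representation_basis)

lemma coordinate_expand:
  assumes C: "finite C" "independent C" "span C = H" and f: "f \<in> dual_space H"
  shows "f = (\<Sum>c\<in>C. fscale (f c) (coordinate C c))"
proof
  fix x
  show "f x = (\<Sum>c\<in>C. fscale (f c) (coordinate C c)) x"
  proof (cases "x \<in> H")
    case True
    then have "f x = f (\<Sum>c\<in>C. scale (representation C x c) c)"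
      using C by (simp add: sum_representation_eq)
    also have "\<dots> = (\<Sum>c\<in>C. representation C x c * f c)"
      using C(3) span_base f by (intro dual_space_sum) auto
    finally show ?thesis
      using True by (simp add: sum_apply fscale_def coordinate_def mult.commute)
  next
    case False
    then show ?thesis
      using f by (simp add: sum_apply fscale_def coordinate_def dual_space_def)
  qed
qed

text \<open>The coordinate functionals of a basis of H and the simple roots are two bases of
  \<open>dual_space H\<close>. This identifies the rank, given as the dimension of H, with the
  number of simple roots.\<close>

lemma card_simple: "card \<Pi> = dim H"
proof -
  obtain C where C: "C \<subseteq> H" "finite C" "independent C" "span C = H"
    by (rule cartan_basis)
  let ?D = "coordinate C ` C"
  have eval: "coordinate C c d = (if c = d then 1 else 0)" if "d \<in> C" for c d
    using coordinate_basis C that by blast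
  have inj: "inj_on (coordinate C) C"
  proof (rule inj_onI)
    fix c d assume "c \<in> C" "d \<in> C" "coordinate C c = coordinate C d"
    then show "c = d" using eval[of d c] eval[of d d] by (auto split: if_splits)
  qed
  have "functionals.independent ?D"
  proof (rule functionals.independent_if_scalars_zero)
    show "finite ?D" using C by simp
  next
    fix f d assume "(\<Sum>x\<in>?D. fscale (f x) x) = 0" "d \<in> ?D"
    then obtain c where c: "c \<in> C" "d = coordinate C c"
      and 0: "(\<Sum>x\<in>C. fscale (f (coordinate C x)) (coordinate C x)) = 0"
      using inj by (auto simp: sum.reindex)
    have "0 = (\<Sum>x\<in>C. f (coordinate C x) * coordinate C x c)"
      using fun_cong[OF 0, of c] by (simp add: sum_apply fscale_def)
    also have "\<dots> = (\<Sum>x\<in>C. if x = c then f (coordinate C c) else 0)"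
      by (intro sum.cong refl) (auto simp: eval c)
    finally show "f d = 0"
      using C c by (simp add: sum.delta)
  qed
  moreover have "?D \<subseteq> dual_space H"
    using coordinate_dual_space C by blast
  moreover have "dual_space H \<subseteq> functionals.span ?D"
  proof
    fix f assume "f \<in> dual_space H"
    then have "f = (\<Sum>c\<in>C. fscale (f c) (coordinate C c))"
      using coordinate_expand C by blast
    also have "\<dots> \<in> functionals.span ?D"
      by (intro functionals.span_sum functionals.span_scale functionals.span_base) auto
    finally show "f \<in> functionals.span ?D" .
  qed
  ultimately have "card ?D = functionals.dim (dual_space H)"
    by (intro functionals.basis_card_eq_dim)
  moreover have "card \<Pi> = functionals.dim (dual_space H)"
    using independent_simple span_simple functionals.span_superset
    by (intro functionals.basis_card_eq_dim) auto
  moreover have "card ?D = card C"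
    using inj by (rule card_image)
  moreover have "card C = dim H"
    using C by (intro basis_card_eq_dim) auto
  ultimately show ?thesis by simp
qed

lemma exists_coweights:
  "\<exists>u. \<forall>\<alpha>\<in>\<Pi>. u \<alpha> \<in> H \<and> (\<forall>\<beta>\<in>\<Pi>. \<beta> (u \<alpha>) = (if \<beta> = \<alpha> then 1 else 0))"
proof -
  obtain C where C: "C \<subseteq> H" "finite C" "independent C" "span C = H"
    by (rule cartan_basis)
  let ?P = "\<lambda>c. functionals.representation \<Pi> (coordinate C c)"
  \<comment> \<open>The coefficients form the inverse matrix: row c expands the coordinate
    functional of c in simple roots. Thus \<beta> takes at \<open>u \<alpha>\<close> the coefficient
    of \<alpha> in the expansion of \<beta> itself.\<close>
  define u where "u \<alpha> = (\<Sum>c\<in>C. scale (?P c \<alpha>) c)" for \<alpha>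
  have "u \<alpha> \<in> H" for \<alpha>
    unfolding u_def using C by (intro subspace_sum subspace_scale subspace_H) auto
  moreover have "\<beta> (u \<alpha>) = (if \<beta> = \<alpha> then 1 else 0)" if \<alpha>: "\<alpha> \<in> \<Pi>" and \<beta>: "\<beta> \<in> \<Pi>" for \<alpha> \<beta>
  proof -
    have mem: "coordinate C c \<in> functionals.span \<Pi>" for c
      using span_simple coordinate_dual_space C by blast
    have "\<beta> (u \<alpha>) = (\<Sum>c\<in>C. ?P c \<alpha> * \<beta> c)"
      unfolding u_def using C \<beta> simple_dual_space by (intro dual_space_sum) auto
    also have "\<dots> = (\<Sum>c\<in>C. functionals.representation \<Pi> (fscale (\<beta> c) (coordinate C c)) \<alpha>)"
      using functionals.representation_scale[OF independent_simple mem] by (simp add: mult.commute)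
    also have "\<dots> = functionals.representation \<Pi> (\<Sum>c\<in>C. fscale (\<beta> c) (coordinate C c)) \<alpha>"
      by (subst functionals.representation_sum[OF independent_simple])
        (auto intro: functionals.span_scale mem)
    also have "(\<Sum>c\<in>C. fscale (\<beta> c) (coordinate C c)) = \<beta>"
      using coordinate_expand[of C \<beta>] C simple_dual_space \<beta> by simp
    finally show ?thesis
      using functionals.representation_basis[OF independent_simple \<beta>] by auto
  qed
  ultimately show ?thesis by blast
qed

definition coweight :: "('g \<Rightarrow> complex) \<Rightarrow> 'g" where
  "coweight = (SOME u. \<forall>\<alpha>\<in>\<Pi>. u \<alpha> \<in> H \<and> (\<forall>\<beta>\<in>\<Pi>. \<beta> (u \<alpha>) = (if \<beta> = \<alpha> then 1 else 0)))"

lemma coweight_in_H: "\<alpha> \<in> \<Pi> \<Longrightarrow> coweight \<alpha> \<in> H"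
  and simple_coweight: "\<alpha> \<in> \<Pi> \<Longrightarrow> \<beta> \<in> \<Pi> \<Longrightarrow> \<beta> (coweight \<alpha>) = (if \<beta> = \<alpha> then 1 else 0)"
  using someI_ex[OF exists_coweights, folded coweight_def] by auto

text \<open>Coefficients with respect to \<Pi> are read off at the coweights; signs and integrality
  of root coefficients are used in this form below.\<close>

lemma combination_coweight:
  "\<alpha> \<in> \<Pi> \<Longrightarrow> (\<Sum>\<beta>\<in>\<Pi>. fscale (m \<beta>) \<beta>) (coweight \<alpha>) = m \<alpha>"
proof -
  assume \<alpha>: "\<alpha> \<in> \<Pi>"
  have "(\<Sum>\<beta>\<in>\<Pi>. fscale (m \<beta>) \<beta>) (coweight \<alpha>) = (\<Sum>\<beta>\<in>\<Pi>. if \<beta> = \<alpha> then m \<alpha> else 0)"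
    unfolding sum_apply fscale_def by (intro sum.cong refl) (auto simp: simple_coweight \<alpha>)
  then show ?thesis
    using \<alpha> finite_simple by (simp add: sum.delta)
qed

lemma expand_simple:
  assumes "f \<in> dual_space H"
  shows "f = (\<Sum>\<alpha>\<in>\<Pi>. fscale (f (coweight \<alpha>)) \<alpha>)"
proof -
  have "f \<in> functionals.span \<Pi>" using assms span_simple by simp
  then obtain m where m: "f = (\<Sum>\<alpha>\<in>\<Pi>. fscale (m \<alpha>) \<alpha>)"
    using functionals.span_finite[OF finite_simple] by auto
  have "f (coweight \<alpha>) = m \<alpha>" if "\<alpha> \<in> \<Pi>" for \<alpha>
    using combination_coweight[OF that, of m] m by simp
  then show ?thesis
    using m by (metis (no_types, lifting) sum.cong)
qed

lemma expand_simple_apply: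
  "f \<in> dual_space H \<Longrightarrow> f h = (\<Sum>\<alpha>\<in>\<Pi>. f (coweight \<alpha>) * \<alpha> h)"
  using fun_cong[OF expand_simple, of f h] by (simp add: sum_apply fscale_def)

lemma root_coweight:
  assumes "\<gamma> \<in> roots H"
  obtains m :: "('g \<Rightarrow> complex) \<Rightarrow> int" where "\<And>\<alpha>. \<alpha> \<in> \<Pi> \<Longrightarrow> \<gamma> (coweight \<alpha>) = of_int (m \<alpha>)"
    "(\<forall>\<alpha>\<in>\<Pi>. m \<alpha> \<ge> 0) \<or> (\<forall>\<alpha>\<in>\<Pi>. m \<alpha> \<le> 0)"
proof -
  obtain m :: "('g \<Rightarrow> complex) \<Rightarrow> int" where m: "\<gamma> = (\<Sum>\<alpha>\<in>\<Pi>. fscale (of_int (m \<alpha>)) \<alpha>)"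
    "(\<forall>\<alpha>\<in>\<Pi>. m \<alpha> \<ge> 0) \<or> (\<forall>\<alpha>\<in>\<Pi>. m \<alpha> \<le> 0)"
    using base assms unfolding simple_roots_def by blast
  then show ?thesis
    using that combination_coweight[of _ "\<lambda>\<alpha>. of_int (m \<alpha>)"] by simp
qed

lemma positive_root_iff:
  "\<gamma> \<in> positive_roots H \<Pi> \<longleftrightarrow> \<gamma> \<in> roots H \<and> (\<forall>\<alpha>\<in>\<Pi>. \<exists>n. \<gamma> (coweight \<alpha>) = of_nat n)"
proof safe
  assume \<gamma>: "\<gamma> \<in> positive_roots H \<Pi>"
  then show "\<gamma> \<in> roots H" by (simp add: positive_roots_def)
  fix \<alpha> assume "\<alpha> \<in> \<Pi>"
  with \<gamma> show "\<exists>n. \<gamma> (coweight \<alpha>) = of_nat n"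
    using combination_coweight[of \<alpha>] by (auto simp: positive_roots_def)
next
  assume \<gamma>: "\<gamma> \<in> roots H" and "\<forall>\<alpha>\<in>\<Pi>. \<exists>n. \<gamma> (coweight \<alpha>) = of_nat n"
  then obtain m where m: "\<forall>\<alpha>\<in>\<Pi>. \<gamma> (coweight \<alpha>) = of_nat (m \<alpha>)" by metis
  have "\<gamma> = (\<Sum>\<alpha>\<in>\<Pi>. fscale (\<gamma> (coweight \<alpha>)) \<alpha>)"
    using expand_simple root_dual_space[OF \<gamma>] .
  also have "\<dots> = (\<Sum>\<alpha>\<in>\<Pi>. fscale (of_nat (m \<alpha>)) \<alpha>)"
    using m by (intro sum.cong) auto
  finally show "\<gamma> \<in> positive_roots H \<Pi>"
    using \<gamma> by (auto simp: positive_roots_def)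
qed

section \<open>Positivity of the Killing form on real vectors\<close>

lemma weight_coweight_real: "b \<in> weight_basis \<Longrightarrow> \<alpha> \<in> \<Pi> \<Longrightarrow> weight b (coweight \<alpha>) \<in> \<real>"
  using weight_zero_or_root[of b] root_coweight[of "weight b"] by (metis Reals_0 Reals_of_int zero_fun_apply)

lemma weight_real:
  assumes "b \<in> weight_basis" "\<And>\<alpha>. \<alpha> \<in> \<Pi> \<Longrightarrow> \<alpha> h \<in> \<real>"
  shows "weight b h \<in> \<real>"
  unfolding expand_simple_apply[OF weight(1)[OF assms(1)], of h]
  using assms weight_coweight_real by (intro sum_in_Reals Reals_mult)

text \<open>All weights are real at h, so \<open>killing h h\<close> is a sum of real squares, and
  the weight \<gamma> contributes a positive one.\<close>

lemma killing_definite: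
  assumes h: "h \<in> H" "\<And>\<alpha>. \<alpha> \<in> \<Pi> \<Longrightarrow> \<alpha> h \<in> \<real>" and \<gamma>: "\<gamma> \<in> roots H" "\<gamma> h \<noteq> 0"
  shows "Re (killing h h) > 0"
proof -
  obtain b where b: "b \<in> weight_basis" "\<gamma> = weight b"
    using root_is_weight \<gamma>(1) by blast
  have real: "weight b h = of_real (Re (weight b h))" if "b \<in> weight_basis" for b
    using weight_real[of b h] h(2) that by (simp add: of_real_Re)
  have "Re (killing h h) = (\<Sum>b\<in>weight_basis. (Re (weight b h))\<^sup>2)"
    unfolding killing_cartan[OF h(1) h(1)] Re_sum
  proof (intro sum.cong refl)
    fix b assume "b \<in> weight_basis"
    then show "Re (weight b h * weight b h) = (Re (weight b h))\<^sup>2"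
      by (subst (1 2) real) (simp_all add: power2_eq_square)
  qed
  also have "\<dots> > 0"
    using finite_weight_basis b(1)
  proof (rule sum_pos2)
    show "(Re (weight b h))\<^sup>2 > 0"
      using real[OF b(1)] \<gamma>(2) b(2) by (metis of_real_0 zero_less_power2)
  qed simp
  finally show ?thesis .
qed

text \<open>The existence of a root guarantees a simple root \<alpha>, and
  \<open>killing_definite\<close> applies to its coweight, where \<alpha> has the value 1.\<close>

lemma killing_nondegenerate:
  assumes \<gamma>: "\<gamma> \<in> roots H" and x: "\<And>y. killing x y = 0"
  shows "x = 0"
proof -
  have "\<Pi> \<noteq> {}"
    using \<gamma> expand_simple root_dual_space root_nonzero by fastforce
  then obtain \<alpha> where \<alpha>: "\<alpha> \<in> \<Pi>" by blast
  then have "Re (killing (coweight \<alpha>) (coweight \<alpha>)) > 0"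
    using simple_subset_roots
    by (intro killing_definite[of _ \<alpha>]) (auto simp: coweight_in_H simple_coweight)
  then have "killing (coweight \<alpha>) (coweight \<alpha>) \<noteq> 0" by auto
  then show ?thesis
    using killing_radical_trivial x by blast
qed

text \<open>\<open>coroot_vector \<alpha>\<close> represents \<open>\<alpha>\<close> with respect to the Killing form and is a bracket of root
  vectors for \<open>\<alpha>\<close> and \<open>- \<alpha>\<close>; unlike the coroot it is not normalized.\<close>

definition coroot_vector :: "('g \<Rightarrow> complex) \<Rightarrow> 'g" where
  "coroot_vector \<alpha> = (SOME t. t \<in> H \<and> (\<forall>h\<in>H. killing t h = \<alpha> h) \<and>
     (\<exists>x\<in>root_space H \<alpha>. \<exists>y\<in>root_space H (- \<alpha>). t = br x y))"

lemma coroot_vector: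
  assumes \<alpha>: "\<alpha> \<in> roots H"
  shows "coroot_vector \<alpha> \<in> H"
    and "h \<in> H \<Longrightarrow> killing (coroot_vector \<alpha>) h = \<alpha> h"
    and "\<exists>x\<in>root_space H \<alpha>. \<exists>y\<in>root_space H (- \<alpha>). coroot_vector \<alpha> = br x y"
proof -
  obtain x where x: "x \<noteq> 0" "x \<in> root_space H \<alpha>"
    by (rule root_vector[OF \<alpha>])
  then obtain z where z: "killing x z \<noteq> 0"
    using killing_nondegenerate[OF \<alpha>] by blast
  have "killing x z = (\<Sum>b\<in>weight_basis. representation weight_basis z b * killing x b)"
    by (subst weight_basis_expand[of z]) (rule killing_sum_right)
  with z obtain b where b: "b \<in> weight_basis" "killing x b \<noteq> 0"
    by (metis (no_types, lifting) mult_zero_right sum.neutral)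
  then have "weight b = - \<alpha>"
    using killing_root_spaces[OF x(2) weight(2)] weight(1) root_dual_space[OF \<alpha>] by blast
  \<comment> \<open>The scaling makes \<open>killing x y\<close> equal to 1, so that by invariance
    \<open>br x y\<close> represents \<alpha> exactly.\<close>
  define y where "y = scale (1 / killing x b) b"
  have y: "y \<in> root_space H (- \<alpha>)"
    using weight(2)[OF b(1)] \<open>weight b = - \<alpha>\<close>
    by (simp add: y_def root_space_def br_scale_right mult.commute)
  have xy: "killing x y = 1"
    using b by (simp add: y_def killing_scale_right)
  have "br x y \<in> H"
    using br_root_space[OF x(2) y] root_space_zero_subset by simp
  moreover have "killing (br x y) h = \<alpha> h" if "h \<in> H" for h
  proof -
    have "br y h = scale (\<alpha> h) y"
      using br_skew[of h y] root_spaceD[OF y that] by simp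
    then show ?thesis
      by (simp add: killing_invariant killing_scale_right xy)
  qed
  ultimately have "\<exists>t. t \<in> H \<and> (\<forall>h\<in>H. killing t h = \<alpha> h) \<and>
     (\<exists>x\<in>root_space H \<alpha>. \<exists>y\<in>root_space H (- \<alpha>). t = br x y)"
    using x y by blast
  from someI_ex[OF this]
  show "coroot_vector \<alpha> \<in> H" "h \<in> H \<Longrightarrow> killing (coroot_vector \<alpha>) h = \<alpha> h"
    "\<exists>x\<in>root_space H \<alpha>. \<exists>y\<in>root_space H (- \<alpha>). coroot_vector \<alpha> = br x y"
    by (auto simp: coroot_vector_def)
qed

text \<open>The imaginary parts of the coordinates of \<open>coroot_vector \<beta>\<close> form a vector on which the
  weights are real and which is Killing-orthogonal to all coweights, hence to itself.\<close>

lemma simple_coroot_vector_real: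
  assumes \<alpha>: "\<alpha> \<in> \<Pi>" and \<beta>: "\<beta> \<in> roots H"
  shows "\<alpha> (coroot_vector \<beta>) \<in> \<real>"
proof -
  define t where "t = coroot_vector \<beta>"
  have t: "t \<in> H" "\<And>h. h \<in> H \<Longrightarrow> killing t h = \<beta> h"
    using coroot_vector[OF \<beta>] by (auto simp: t_def)
  define u where "u = (\<Sum>\<delta>\<in>\<Pi>. scale (of_real (Im (\<delta> t))) (coweight \<delta>))"
  have u: "u \<in> H"
    unfolding u_def using coweight_in_H by (intro subspace_sum subspace_scale subspace_H)
  have dual_u: "f u = (\<Sum>\<delta>\<in>\<Pi>. of_real (Im (\<delta> t)) * f (coweight \<delta>))" if "f \<in> dual_space H" for f
    unfolding u_def using that coweight_in_H by (rule dual_space_sum)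
  have simple_u: "\<delta> u = of_real (Im (\<delta> t))" if \<delta>: "\<delta> \<in> \<Pi>" for \<delta>
  proof -
    have "\<delta> u = (\<Sum>\<epsilon>\<in>\<Pi>. if \<epsilon> = \<delta> then of_real (Im (\<delta> t)) else 0)"
      unfolding dual_u[OF simple_dual_space[OF \<delta>]]
      by (intro sum.cong refl) (auto simp: simple_coweight \<delta>)
    then show ?thesis
      using \<delta> finite_simple by (simp add: sum.delta)
  qed
  have weight_u: "weight b u = of_real (Im (weight b t))" if b: "b \<in> weight_basis" for b
  proof -
    have "Im (weight b (coweight \<delta>) * \<delta> t) = Re (weight b (coweight \<delta>)) * Im (\<delta> t)"
      if "\<delta> \<in> \<Pi>" for \<delta>
      using weight_coweight_real[OF b that] by (simp add: complex_is_Real_iff)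
    then have "Im (weight b t) = (\<Sum>\<delta>\<in>\<Pi>. Re (weight b (coweight \<delta>)) * Im (\<delta> t))"
      unfolding expand_simple_apply[OF weight(1)[OF b], of t] Im_sum by (intro sum.cong refl) simp
    moreover have "weight b u = (\<Sum>\<delta>\<in>\<Pi>. of_real (Re (weight b (coweight \<delta>)) * Im (\<delta> t)))"
      unfolding dual_u[OF weight(1)[OF b]]
      using weight_coweight_real[OF b] by (intro sum.cong refl) (simp add: of_real_Re mult.commute)
    ultimately show ?thesis by simp
  qed
  have "killing u (coweight \<delta>) = 0" if \<delta>: "\<delta> \<in> \<Pi>" for \<delta>
  proof -
    obtain m where "\<beta> (coweight \<delta>) = of_int (m \<delta>)"
      using root_coweight[OF \<beta>] \<delta> by metis
    \<comment> \<open>The value of t against a coweight is a root coefficient, an integer; its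
      imaginary part will be recognized as \<open>killing u (coweight \<delta>)\<close>.\<close>
    then have "0 = Im (killing t (coweight \<delta>))"
      using t(2) coweight_in_H \<delta> by simp
    also have "\<dots> = (\<Sum>b\<in>weight_basis. Im (weight b t) * Re (weight b (coweight \<delta>)))"
      unfolding killing_cartan[OF t(1) coweight_in_H[OF \<delta>]] Im_sum
    proof (intro sum.cong refl)
      fix b assume "b \<in> weight_basis"
      then have "Im (weight b (coweight \<delta>)) = 0"
        using weight_coweight_real \<delta> by (simp add: complex_is_Real_iff)
      then show "Im (weight b t * weight b (coweight \<delta>)) = Im (weight b t) * Re (weight b (coweight \<delta>))"
        by simp
    qed
    finally have "complex_of_real (\<Sum>b\<in>weight_basis. Im (weight b t) * Re (weight b (coweight \<delta>))) = 0"
      by simp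
    also have "complex_of_real (\<Sum>b\<in>weight_basis. Im (weight b t) * Re (weight b (coweight \<delta>)))
        = killing u (coweight \<delta>)"
      unfolding killing_cartan[OF u coweight_in_H[OF \<delta>]] of_real_sum
      by (intro sum.cong refl)
        (use weight_u weight_coweight_real \<delta> in \<open>simp add: of_real_Re\<close>)
    finally show ?thesis .
  qed
  then have "killing u u = 0"
    by (subst (2) u_def) (simp add: killing_sum_right)
  moreover have "\<delta> u \<in> \<real>" if "\<delta> \<in> \<Pi>" for \<delta>
    using simple_u[OF that] by simp
  \<comment> \<open>Otherwise \<open>killing_definite\<close>, with \<alpha> as the root that does
    not vanish at u, would make \<open>killing u u\<close> nonzero.\<close>
  ultimately have "\<alpha> u = 0"
    using killing_definite[OF u, of \<alpha>] \<alpha> simple_subset_roots by auto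
  then show ?thesis
    using simple_u[OF \<alpha>] by (simp add: t_def complex_is_Real_iff)
qed

text \<open>The value in question is the Killing square of the coroot vector, on which all simple
  roots are real. Some weight is nonzero there, since otherwise the functional \<beta> that it
  represents would vanish.\<close>

lemma root_coroot_vector_pos:
  assumes \<beta>: "\<beta> \<in> roots H"
  shows "Re (\<beta> (coroot_vector \<beta>)) > 0"
proof -
  let ?t = "coroot_vector \<beta>"
  note t = coroot_vector(1,2)[OF \<beta>]
  have "\<exists>b\<in>weight_basis. weight b ?t \<noteq> 0"
  proof (rule ccontr)
    assume "\<not> ?thesis"
    then have "\<beta> h = 0" if "h \<in> H" for h
      using killing_cartan[OF t(1) that] t(2)[OF that] by simp
    then have "\<beta> = 0"
      by (intro dual_space_eqI) (use root_dual_space[OF \<beta>] dual_space_zero in auto)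
    then show False using root_nonzero[OF \<beta>] by simp
  qed
  then obtain b where "b \<in> weight_basis" "weight b ?t \<noteq> 0" by blast
  moreover from this have "weight b \<in> roots H"
    using weight_zero_or_root[of b] by auto
  ultimately have "Re (killing ?t ?t) > 0"
    using t(1) simple_coroot_vector_real \<beta> by (intro killing_definite) auto
  then show ?thesis using t by simp
qed

text \<open>A version of the sl(2) string argument. If \<gamma> - \<alpha> is not a root, y kills a
  root vector v of \<gamma>; then y sends each iterate \<open>w (Suc k)\<close> to a nonzero
  multiple of \<open>w k\<close>, so no iterate vanishes and there are infinitely many
  roots.\<close>

lemma root_diff:
  assumes \<gamma>: "\<gamma> \<in> roots H" and \<alpha>: "\<alpha> \<in> roots H" and ne: "\<gamma> \<noteq> \<alpha>"
    and pos: "Re (\<gamma> (coroot_vector \<alpha>)) > 0"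
  shows "\<gamma> - \<alpha> \<in> roots H"
proof (rule ccontr)
  assume not_root: "\<gamma> - \<alpha> \<notin> roots H"
  let ?t = "coroot_vector \<alpha>"
  have t: "?t \<in> H" and t_pos: "Re (\<alpha> ?t) > 0"
    using coroot_vector(1) root_coroot_vector_pos \<alpha> by auto
  obtain x y where x: "x \<in> root_space H \<alpha>" and y: "y \<in> root_space H (- \<alpha>)" and xy: "?t = br x y"
    using coroot_vector(3)[OF \<alpha>] by blast
  obtain v where v: "v \<noteq> 0" "v \<in> root_space H \<gamma>"
    by (rule root_vector[OF \<gamma>])
  define w where "w k = (br x ^^ k) v" for k
  have w_Suc: "w (Suc k) = br x (w k)" for k by (simp add: w_def)
  have w_space: "w k \<in> root_space H (\<gamma> + fscale (of_nat k) \<alpha>)" for k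
  proof (induction k)
    case 0
    have "\<gamma> + fscale 0 \<alpha> = \<gamma>" by (auto simp: fscale_def)
    then show ?case using v by (simp add: w_def)
  next
    case (Suc k)
    have "\<alpha> + (\<gamma> + fscale (of_nat k) \<alpha>) = \<gamma> + fscale (of_nat (Suc k)) \<alpha>"
      by (auto simp: fscale_def algebra_simps)
    with br_root_space[OF x Suc] show ?case by (simp only: w_Suc)
  qed
  \<comment> \<open>The sum of the eigenvalues of \<open>?t\<close> on \<open>w 0\<close>, ...,
    \<open>w k\<close>, which accumulate as y is moved past the factors x.\<close>
  define d where "d k = (\<Sum>j\<le>k. \<gamma> ?t + of_nat j * \<alpha> ?t)" for k :: nat
  have step: "br y (br x z) = br x (br y z) - br ?t z" for z
    unfolding br_derivation[of y x z] xy using br_skew[of x y] br_scale_left[of "- 1" "br x y" z] by simp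
  have br_t: "br ?t (w k) = scale (\<gamma> ?t + of_nat k * \<alpha> ?t) (w k)" for k
    using root_spaceD[OF w_space t] by (simp add: fscale_def)
  have yw: "br y (w (Suc k)) = scale (- d k) (w k)" for k
  proof (induction k)
    case 0
    \<comment> \<open>A nonzero vector here would make \<gamma> - \<alpha> a root; it is not the
      zero functional because \<gamma> and \<alpha> differ.\<close>
    have "br y v \<in> root_space H (\<gamma> - \<alpha>)"
      using br_root_space[OF y v(2)] by simp
    then have "br y v = 0"
      using not_root ne rootI[of "\<gamma> - \<alpha>"] dual_space_diff root_dual_space \<gamma> \<alpha>
      by (metis right_minus_eq)
    then show ?case
      using br_t[of 0] by (simp add: w_Suc step d_def w_def)
  next
    case (Suc k)
    have "br y (w (Suc (Suc k))) = br x (br y (w (Suc k))) - br ?t (w (Suc k))"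
      by (simp only: w_Suc[of "Suc k"] step)
    also have "\<dots> = scale (- d k) (w (Suc k)) - scale (\<gamma> ?t + of_nat (Suc k) * \<alpha> ?t) (w (Suc k))"
      by (simp only: Suc br_scale_right w_Suc[symmetric] br_t)
    also have "\<dots> = scale (- d (Suc k)) (w (Suc k))"
      unfolding scale_left_diff_distrib[symmetric] by (simp add: d_def algebra_simps)
    finally show ?case .
  qed
  \<comment> \<open>Positive real parts suffice: they keep \<open>d k\<close> away from zero, and
    they also show that the weights of the string are nonzero.\<close>
  have string_pos: "Re (\<gamma> ?t + of_nat k * \<alpha> ?t) > 0" for k
    using pos t_pos by (simp add: add_pos_nonneg)
  have "Re (d k) > 0" for k
    unfolding d_def Re_sum using string_pos by (intro sum_pos) auto
  then have "d k \<noteq> 0" for k by (metis less_irrefl zero_complex.simps(1))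
  then have "w k \<noteq> 0" for k
    by (induction k) (use v yw in \<open>force simp: w_def\<close>, metis yw br_zero_right neg_equal_0_iff_equal scale_eq_0_iff)
  moreover have "\<gamma> + fscale (of_nat k) \<alpha> \<noteq> 0" for k
  proof
    assume "\<gamma> + fscale (of_nat k) \<alpha> = 0"
    from fun_cong[OF this, of ?t] have "\<gamma> ?t + of_nat k * \<alpha> ?t = 0"
      by (simp add: fscale_def)
    then show False using string_pos[of k] by simp
  qed
  ultimately have "\<gamma> + fscale (of_nat k) \<alpha> \<in> roots H" for k
    using w_space \<gamma> \<alpha> root_dual_space dual_space_add dual_space_fscale by (meson rootI)
  then have "range (\<lambda>k::nat. \<gamma> + fscale (of_nat k) \<alpha>) \<subseteq> roots H" by blast
  moreover have "inj (\<lambda>k::nat. \<gamma> + fscale (of_nat k) \<alpha>)"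
  proof (rule injI)
    fix j k :: nat assume "\<gamma> + fscale (of_nat j) \<alpha> = \<gamma> + fscale (of_nat k) \<alpha>"
    from fun_cong[OF this, of ?t] have "of_nat j * \<alpha> ?t = of_nat k * \<alpha> ?t"
      by (simp add: fscale_def)
    then show "j = k" using t_pos by auto
  qed
  ultimately show False
    using finite_roots by (meson finite_imageD finite_subset infinite_UNIV_nat)
qed

text \<open>Expanding the positive number \<gamma>(\<open>?t\<close>) in simple roots with
  nonnegative coefficients yields a simple \<alpha> that is positive on \<open>?t\<close>, to which
  \<open>root_diff\<close> applies.\<close>

lemma positive_root_diff_simple:
  assumes \<gamma>: "\<gamma> \<in> positive_roots H \<Pi>" "\<gamma> \<notin> \<Pi>"
  obtains \<alpha> where "\<alpha> \<in> \<Pi>" "\<gamma> - \<alpha> \<in> positive_roots H \<Pi>"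
proof -
  have root: "\<gamma> \<in> roots H" and nat: "\<forall>\<alpha>\<in>\<Pi>. \<exists>n. \<gamma> (coweight \<alpha>) = of_nat n"
    using \<gamma>(1) positive_root_iff by auto
  then obtain n where n: "\<And>\<alpha>. \<alpha> \<in> \<Pi> \<Longrightarrow> \<gamma> (coweight \<alpha>) = of_nat (n \<alpha>)" by metis
  let ?t = "coroot_vector \<gamma>"
  have "0 < Re (\<gamma> ?t)"
    using root by (rule root_coroot_vector_pos)
  also have "\<gamma> ?t = (\<Sum>\<alpha>\<in>\<Pi>. of_nat (n \<alpha>) * \<alpha> ?t)"
    using expand_simple_apply[OF root_dual_space[OF root], of ?t] n by simp
  finally have "0 < (\<Sum>\<alpha>\<in>\<Pi>. real (n \<alpha>) * Re (\<alpha> ?t))" by simp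
  then obtain \<alpha> where \<alpha>: "\<alpha> \<in> \<Pi>" and "real (n \<alpha>) * Re (\<alpha> ?t) > 0"
    by (meson not_le sum_nonpos)
  then have "Re (\<alpha> ?t) > 0"
    by (simp add: zero_less_mult_iff)
  have \<alpha>_root: "\<alpha> \<in> roots H"
    using \<alpha> simple_subset_roots by blast
  \<comment> \<open>Both values are the Killing product of the two coroot vectors;
    \<open>root_diff\<close> asks for positivity at that of \<alpha>.\<close>
  have "\<gamma> (coroot_vector \<alpha>) = \<alpha> ?t"
    using coroot_vector(1,2) root \<alpha>_root killing_commute by metis
  then have diff: "\<gamma> - \<alpha> \<in> roots H"
    using root_diff root \<alpha>_root \<gamma>(2) \<alpha> \<open>Re (\<alpha> ?t) > 0\<close> by metis
  obtain m where m: "\<And>\<beta>. \<beta> \<in> \<Pi> \<Longrightarrow> (\<gamma> - \<alpha>) (coweight \<beta>) = of_int (m \<beta>)"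
    and sign: "(\<forall>\<beta>\<in>\<Pi>. m \<beta> \<ge> 0) \<or> (\<forall>\<beta>\<in>\<Pi>. m \<beta> \<le> 0)"
    using root_coweight[OF diff] by blast
  have m_eq: "m \<beta> = int (n \<beta>) - (if \<beta> = \<alpha> then 1 else 0)" if "\<beta> \<in> \<Pi>" for \<beta>
  proof -
    have "(of_int (m \<beta>) :: complex) = of_int (int (n \<beta>) - (if \<beta> = \<alpha> then 1 else 0))"
      using m[OF that] n[OF that] simple_coweight[OF that \<alpha>] by (simp split: if_splits)
    then show ?thesis by (simp only: of_int_eq_iff)
  qed
  \<comment> \<open>A negative coefficient can occur only at \<alpha>, with
    \<open>n \<alpha> = 0\<close>; the sign condition then forces every other
    \<open>n \<beta>\<close> to vanish, so \<gamma> would be zero.\<close>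
  have "\<forall>\<beta>\<in>\<Pi>. m \<beta> \<ge> 0"
  proof (rule ccontr)
    assume "\<not> ?thesis"
    with sign m_eq have zero: "n \<beta> = 0" if "\<beta> \<in> \<Pi>" for \<beta>
      using that by (smt (verit) of_nat_0_le_iff of_nat_eq_0_iff)
    then have "\<gamma> h = 0" for h
      using expand_simple_apply[OF root_dual_space[OF root], of h] n by simp
    then show False
      using root_nonzero[OF root] by (simp add: fun_eq_iff)
  qed
  then have "(\<gamma> - \<alpha>) (coweight \<beta>) = of_nat (nat (m \<beta>))" if "\<beta> \<in> \<Pi>" for \<beta>
    using m[OF that] that by simp
  then have "\<gamma> - \<alpha> \<in> positive_roots H \<Pi>"
    using positive_root_iff diff by blast
  with \<alpha> show ?thesis by (rule that)
qed

end

section \<open>Ideals containing prescribed simple roots\<close>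

context based_simple_lie_algebra
begin

section \<open>Supports of roots and spans of simple roots\<close>

lemma simple_subset_positive: "\<Pi> \<subseteq> positive_roots H \<Pi>"
proof
  fix \<alpha> assume \<alpha>: "\<alpha> \<in> \<Pi>"
  have "\<exists>n. \<alpha> (coweight \<beta>) = of_nat n" if "\<beta> \<in> \<Pi>" for \<beta>
    using simple_coweight[OF that \<alpha>] by (intro exI[of _ "if \<alpha> = \<beta> then 1 else 0"]) simp
  with \<alpha> show "\<alpha> \<in> positive_roots H \<Pi>"
    using positive_root_iff simple_subset_roots by blast
qed

lemma positive_root_add:
  assumes "\<gamma> \<in> positive_roots H \<Pi>" "\<nu> \<in> positive_roots H \<Pi>" "\<gamma> + \<nu> \<in> roots H"
  shows "\<gamma> + \<nu> \<in> positive_roots H \<Pi>"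
  unfolding positive_root_iff
proof (intro conjI ballI)
  fix \<alpha> assume "\<alpha> \<in> \<Pi>"
  then obtain m n where "\<gamma> (coweight \<alpha>) = of_nat m" "\<nu> (coweight \<alpha>) = of_nat n"
    using assms positive_root_iff by blast
  then show "\<exists>k. (\<gamma> + \<nu>) (coweight \<alpha>) = of_nat k"
    by (intro exI[of _ "m + n"]) simp
qed (rule assms(3))

lemma span_subset_iff:
  assumes J: "J \<subseteq> \<Pi>" and f: "f \<in> dual_space H"
  shows "f \<in> functionals.span J \<longleftrightarrow> (\<forall>\<alpha>\<in>\<Pi> - J. f (coweight \<alpha>) = 0)"
proof
  assume "f \<in> functionals.span J"
  then show "\<forall>\<alpha>\<in>\<Pi> - J. f (coweight \<alpha>) = 0"
  proof (induction rule: functionals.span_induct_alt)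
    case (step c x y)
    have "x (coweight \<alpha>) = 0" if "\<alpha> \<in> \<Pi> - J" for \<alpha>
      using simple_coweight[of \<alpha> x] step.hyps(1) J that by auto
    with step.IH show ?case
      by (simp add: fscale_def)
  qed simp
next
  assume 0: "\<forall>\<alpha>\<in>\<Pi> - J. f (coweight \<alpha>) = 0"
  have "f = (\<Sum>\<alpha>\<in>\<Pi>. fscale (f (coweight \<alpha>)) \<alpha>)"
    using f by (rule expand_simple)
  also have "\<dots> = (\<Sum>\<alpha>\<in>J. fscale (f (coweight \<alpha>)) \<alpha>)"
    using finite_simple J 0 by (intro sum.mono_neutral_right) auto
  also have "\<dots> \<in> functionals.span J"
    by (intro functionals.span_sum functionals.span_scale functionals.span_base)
  finally show "f \<in> functionals.span J" .
qed

text \<open>Nonnegative coefficients cannot cancel, so the support of a sum contains both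
  supports.\<close>

lemma positive_sum_in_span:
  assumes J: "J \<subseteq> \<Pi>" and \<gamma>: "\<gamma> \<in> positive_roots H \<Pi>" and \<nu>: "\<nu> \<in> positive_roots H \<Pi>"
    and "\<gamma> + \<nu> \<in> functionals.span J"
  shows "\<gamma> \<in> functionals.span J" "\<nu> \<in> functionals.span J"
proof -
  have dual: "\<gamma> \<in> dual_space H" "\<nu> \<in> dual_space H"
    using \<gamma> \<nu> positive_root_iff root_dual_space by auto
  have "\<gamma> (coweight \<alpha>) = 0 \<and> \<nu> (coweight \<alpha>) = 0" if "\<alpha> \<in> \<Pi> - J" for \<alpha>
  proof -
    have "\<exists>m. \<gamma> (coweight \<alpha>) = of_nat m" "\<exists>n. \<nu> (coweight \<alpha>) = of_nat n"
      using \<gamma> \<nu> that by (auto simp: positive_root_iff)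
    then obtain m n where mn: "\<gamma> (coweight \<alpha>) = of_nat m" "\<nu> (coweight \<alpha>) = of_nat n"
      by blast
    moreover have "(\<gamma> + \<nu>) (coweight \<alpha>) = 0"
      using span_subset_iff[OF J dual_space_add[OF dual]] assms(4) that by blast
    ultimately have "(of_nat (m + n) :: complex) = 0" by simp
    then show ?thesis
      using mn by (simp only: of_nat_eq_0_iff) simp
  qed
  then show "\<gamma> \<in> functionals.span J" "\<nu> \<in> functionals.span J"
    using span_subset_iff[OF J] dual by auto
qed

lemma simple_in_span_iff:
  assumes J: "J \<subseteq> \<Pi>" and \<alpha>: "\<alpha> \<in> \<Pi>"
  shows "\<alpha> \<in> functionals.span J \<longleftrightarrow> \<alpha> \<in> J"
proof -
  have "\<alpha> \<in> functionals.span J \<longleftrightarrow> (\<forall>\<beta>\<in>\<Pi> - J. \<alpha> (coweight \<beta>) = 0)"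
    using J simple_dual_space[OF \<alpha>] by (rule span_subset_iff)
  also have "\<dots> \<longleftrightarrow> (\<forall>\<beta>\<in>\<Pi> - J. \<alpha> \<noteq> \<beta>)"
    by (intro ball_cong refl) (simp add: simple_coweight \<alpha>)
  also have "\<dots> \<longleftrightarrow> \<alpha> \<in> J"
    using \<alpha> by blast
  finally show ?thesis .
qed

text \<open>Induction on the height, peeling off a simple root \<alpha>: either \<alpha> itself is
  outside J and so in I, or \<gamma> - \<alpha> is still outside the span and in I by induction. In
  both cases adding the other summand stays in I.\<close>

lemma ideal_contains_outside_span:
  assumes J: "J \<subseteq> \<Pi>" and I: "I \<in> Ad_g H \<Pi>" "\<Pi> - J \<subseteq> I"
    and \<gamma>: "\<gamma> \<in> positive_roots H \<Pi>" "\<gamma> \<notin> functionals.span J"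
  shows "\<gamma> \<in> I"
proof -
  \<comment> \<open>Evaluation at the sum of the coweights gives the height. The factor
    \<open>scale 1\<close> only matches the form of \<open>dual_space_sum\<close>.\<close>
  define \<rho> where "\<rho> = (\<Sum>\<alpha>\<in>\<Pi>. scale 1 (coweight \<alpha>))"
  have height: "f \<rho> = (\<Sum>\<alpha>\<in>\<Pi>. f (coweight \<alpha>))" if "f \<in> dual_space H" for f
    unfolding \<rho>_def using dual_space_sum[OF that coweight_in_H, of \<Pi> "\<lambda>x. x" "\<lambda>_. 1"] by simp
  have height_nat: "\<exists>n. \<delta> \<rho> = of_nat n" if \<delta>: "\<delta> \<in> positive_roots H \<Pi>" for \<delta>
  proof -
    obtain n where "\<forall>\<alpha>\<in>\<Pi>. \<delta> (coweight \<alpha>) = of_nat (n \<alpha>)"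
      using \<delta> positive_root_iff by metis
    moreover have "\<delta> \<in> dual_space H"
      using \<delta> positive_root_iff root_dual_space by blast
    ultimately have "\<delta> \<rho> = of_nat (\<Sum>\<alpha>\<in>\<Pi>. n \<alpha>)"
      by (simp add: height)
    then show ?thesis ..
  qed
  have height_simple: "\<alpha> \<rho> = 1" if \<alpha>: "\<alpha> \<in> \<Pi>" for \<alpha>
  proof -
    have "\<alpha> \<rho> = (\<Sum>\<beta>\<in>\<Pi>. if \<alpha> = \<beta> then 1 else 0)"
      unfolding height[OF simple_dual_space[OF \<alpha>]] using \<alpha> simple_coweight
      by (intro sum.cong) auto
    then show ?thesis using \<alpha> finite_simple by (simp add: sum.delta')
  qed
  have closed: "\<gamma> + \<nu> \<in> I" if "\<gamma> \<in> I" "\<nu> \<in> positive_roots H \<Pi>" "\<gamma> + \<nu> \<in> roots H" for \<gamma> \<nu>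
    using I(1) that by (auto simp: Ad_g_def Ad_def)
  have "\<gamma> \<in> I" if "\<gamma> \<rho> = of_nat n" for n
    using that \<gamma>
  proof (induction n arbitrary: \<gamma> rule: less_induct)
    case (less n)
    show ?case
    proof (cases "\<gamma> \<in> \<Pi>")
      case True
      then show ?thesis
        using less.prems I(2) simple_in_span_iff[OF J] by blast
    next
      case False
      then obtain \<alpha> where \<alpha>: "\<alpha> \<in> \<Pi>" and diff: "\<gamma> - \<alpha> \<in> positive_roots H \<Pi>"
        using positive_root_diff_simple less.prems by blast
      have sum: "\<gamma> = (\<gamma> - \<alpha>) + \<alpha>" "\<gamma> = \<alpha> + (\<gamma> - \<alpha>)" by simp_all
      have root: "\<gamma> \<in> roots H"
        using less.prems positive_root_iff by blast
      consider "\<alpha> \<notin> J" | "\<gamma> - \<alpha> \<notin> functionals.span J"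
        using less.prems(3) sum(1) functionals.span_add functionals.span_base by metis
      then show ?thesis
      proof cases
        case 1
        then have "\<alpha> \<in> I"
          using \<alpha> I(2) by blast
        then show ?thesis
          using closed[of \<alpha> "\<gamma> - \<alpha>"] diff root by simp
      next
        case 2
        obtain k where k: "(\<gamma> - \<alpha>) \<rho> = of_nat k"
          using height_nat diff by blast
        then have "(of_nat n :: complex) = of_nat (Suc k)"
          using less.prems(1) height_simple[OF \<alpha>] by (simp add: diff_eq_eq add.commute)
        then have "k < n"
          by (simp only: of_nat_eq_iff)
        then have "\<gamma> - \<alpha> \<in> I"
          using less.IH k diff 2 by blast
        then show ?thesis
          using closed[of "\<gamma> - \<alpha>" \<alpha>] \<alpha> simple_subset_positive root by auto
      qed
    qed
  qed
  then show ?thesis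
    using height_nat \<gamma>(1) by blast
qed

section \<open>Ideals of g(J) inside the ideals of g\<close>

lemma Ad_subset_positive: "I \<in> Ad_g H \<Pi> \<Longrightarrow> I \<subseteq> positive_roots H \<Pi>"
  by (simp add: Ad_g_def Ad_def)

lemma finite_Ad: "finite (Ad_g H \<Pi>)"
proof (rule finite_subset)
  show "Ad_g H \<Pi> \<subseteq> Pow (roots H)"
    by (auto simp: Ad_g_def Ad_def positive_roots_def)
qed (simp add: finite_roots)

text \<open>The inverse adjoins all positive roots outside the span of J, which
  \<open>ideal_contains_outside_span\<close> shows to be forced. The result is an ideal: a sum
  inside the span has both summands there, and any other sum that is a root is one of the adjoined
  roots.\<close>

lemma bij_betw_Ad_sub:
  assumes J: "J \<subseteq> \<Pi>"
  shows "bij_betw (\<lambda>I. I \<inter> functionals.span J) {I \<in> Ad_g H \<Pi>. \<Pi> - J \<subseteq> I} (Ad_sub H \<Pi> J)"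
proof (rule bij_betw_byWitness[where
      f' = "\<lambda>I. I \<union> (positive_roots H \<Pi> - functionals.span J)"])
  let ?P = "positive_roots H \<Pi>" and ?V = "functionals.span J"
  show "\<forall>I\<in>{I \<in> Ad_g H \<Pi>. \<Pi> - J \<subseteq> I}. I \<inter> ?V \<union> (?P - ?V) = I"
    using ideal_contains_outside_span[OF J] Ad_subset_positive by blast
  show "\<forall>I\<in>Ad_sub H \<Pi> J. (I \<union> (?P - ?V)) \<inter> ?V = I"
    by (auto simp: Ad_sub_def Ad_def sub_positive_roots_def)
  show "(\<lambda>I. I \<inter> ?V) ` {I \<in> Ad_g H \<Pi>. \<Pi> - J \<subseteq> I} \<subseteq> Ad_sub H \<Pi> J"
    by (auto simp: Ad_sub_def Ad_g_def Ad_def sub_positive_roots_def sub_roots_def)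
  show "(\<lambda>I. I \<union> (?P - ?V)) ` Ad_sub H \<Pi> J \<subseteq> {I \<in> Ad_g H \<Pi>. \<Pi> - J \<subseteq> I}"
  proof (intro image_subsetI CollectI conjI)
    fix I assume I: "I \<in> Ad_sub H \<Pi> J"
    then have I_sub: "I \<subseteq> ?P \<inter> ?V"
      and I_closed: "\<And>\<gamma> \<nu>. \<gamma> \<in> I \<Longrightarrow> \<nu> \<in> ?P \<inter> ?V \<Longrightarrow> \<gamma> + \<nu> \<in> roots H \<inter> ?V \<Longrightarrow> \<gamma> + \<nu> \<in> I"
      by (auto simp: Ad_sub_def Ad_def sub_positive_roots_def sub_roots_def)
    have "\<gamma> + \<nu> \<in> I \<union> (?P - ?V)"
      if \<gamma>: "\<gamma> \<in> I \<union> (?P - ?V)" and \<nu>: "\<nu> \<in> ?P" and root: "\<gamma> + \<nu> \<in> roots H" for \<gamma> \<nu>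
    proof (cases "\<gamma> + \<nu> \<in> ?V")
      case True
      have "\<gamma> \<in> ?P" using \<gamma> I_sub by blast
      then have "\<gamma> \<in> ?V" "\<nu> \<in> ?V"
        using positive_sum_in_span[OF J _ \<nu> True] by auto
      then show ?thesis
        using I_closed[of \<gamma> \<nu>] \<gamma> \<nu> root True by blast
    next
      case False
      moreover have "\<gamma> + \<nu> \<in> ?P"
        using positive_root_add[OF _ \<nu> root] \<gamma> I_sub by blast
      ultimately show ?thesis by blast
    qed
    then show "I \<union> (?P - ?V) \<in> Ad_g H \<Pi>"
      using I_sub by (auto simp: Ad_g_def Ad_def)
  next
    fix I
    show "\<Pi> - J \<subseteq> I \<union> (?P - ?V)"
      using simple_subset_positive simple_in_span_iff[OF J] by blast
  qed
qed

lemma card_Ad_sub: "J \<subseteq> \<Pi> \<Longrightarrow> card (Ad_sub H \<Pi> J) = card {I \<in> Ad_g H \<Pi>. \<Pi> - J \<subseteq> I}"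
  using bij_betw_same_card[OF bij_betw_Ad_sub] by simp

text \<open>Intersecting with the span keeps the elements of J, so the image of I has no simple root
  of g(J) exactly when I misses J; together with \<Pi> - J \<subseteq> I this fixes I \<inter>
  \<Pi>.\<close>

lemma card_Ad_sub_level_zero:
  assumes J: "J \<subseteq> \<Pi>"
  shows "card (Ad_sub_level H \<Pi> J 0) = card {I \<in> Ad_g H \<Pi>. I \<inter> \<Pi> = \<Pi> - J}"
proof -
  let ?f = "\<lambda>I. I \<inter> functionals.span J" and ?A = "{I \<in> Ad_g H \<Pi>. \<Pi> - J \<subseteq> I}"
  have J_span: "J \<subseteq> functionals.span J"
    by (rule functionals.span_superset)
  have fin: "finite J"
    using J finite_simple finite_subset by blast
  have "Ad_sub_level H \<Pi> J 0 = {I \<in> Ad_sub H \<Pi> J. I \<inter> J = {}}"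
    using fin by (auto simp: Ad_sub_level_def Ad_level_def Ad_sub_def)
  also have "Ad_sub H \<Pi> J = ?f ` ?A"
    using bij_betw_Ad_sub[OF J] by (simp add: bij_betw_def)
  also have "{I \<in> ?f ` ?A. I \<inter> J = {}} = ?f ` {I \<in> Ad_g H \<Pi>. I \<inter> \<Pi> = \<Pi> - J}"
    (is "_ = ?f ` ?B")
  proof -
    have "{I \<in> ?f ` ?A. I \<inter> J = {}} = ?f ` {I \<in> ?A. ?f I \<inter> J = {}}"
      by (simp only: Compr_image_eq)
    also have "{I \<in> ?A. ?f I \<inter> J = {}} = ?B"
    proof (rule Collect_cong)
      fix I
      have "?f I \<inter> J = I \<inter> J"
        using J_span by blast
      then show "I \<in> ?A \<and> ?f I \<inter> J = {} \<longleftrightarrow> I \<in> Ad_g H \<Pi> \<and> I \<inter> \<Pi> = \<Pi> - J"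
        using J by auto
    qed
    finally show ?thesis .
  qed
  also have "card (?f ` ?B) = card ?B"
  proof (rule card_image)
    have "inj_on ?f ?A"
      using bij_betw_Ad_sub[OF J] by (simp add: bij_betw_def)
    then show "inj_on ?f ?B"
      by (rule inj_on_subset) blast
  qed
  finally show ?thesis .
qed

text \<open>The ideals are sorted according to the set J of simple roots that they omit.\<close>

lemma card_Ad_level:
  assumes "i \<le> card \<Pi>"
  shows "card (Ad_g_level H \<Pi> i) =
    (\<Sum>J\<in>{J. J \<subseteq> \<Pi> \<and> card J = card \<Pi> - i}. card (Ad_sub_level H \<Pi> J 0))"
proof -
  let ?S = "{J. J \<subseteq> \<Pi> \<and> card J = card \<Pi> - i}"
  let ?F = "\<lambda>J. {I \<in> Ad_g H \<Pi>. I \<inter> \<Pi> = \<Pi> - J}"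
  have "Ad_g_level H \<Pi> i = (\<Union>J\<in>?S. ?F J)"
  proof (intro set_eqI iffI)
    fix I assume I: "I \<in> Ad_g_level H \<Pi> i"
    have "card (\<Pi> - I \<inter> \<Pi>) = card \<Pi> - i"
      using I finite_simple by (subst card_Diff_subset) (auto simp: Ad_g_level_def Ad_level_def)
    with I show "I \<in> (\<Union>J\<in>?S. ?F J)"
      by (intro UN_I[of "\<Pi> - I \<inter> \<Pi>"]) (auto simp: Ad_g_level_def Ad_level_def Ad_g_def)
  next
    fix I assume "I \<in> (\<Union>J\<in>?S. ?F J)"
    then obtain J where J: "J \<subseteq> \<Pi>" "card J = card \<Pi> - i" "I \<in> Ad_g H \<Pi>" "I \<inter> \<Pi> = \<Pi> - J"
      by blast
    then have "card (I \<inter> \<Pi>) = card \<Pi> - card J"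
      using finite_simple by (metis card_Diff_subset finite_subset)
    \<comment> \<open>Subtraction is truncated; the bound on i turns
      \<open>card \<Pi> - (card \<Pi> - i)\<close> back into i.\<close>
    with J assms show "I \<in> Ad_g_level H \<Pi> i"
      by (simp add: Ad_g_level_def Ad_level_def Ad_g_def)
  qed
  then have "card (Ad_g_level H \<Pi> i) = (\<Sum>J\<in>?S. card (?F J))"
    using finite_simple finite_Ad by (simp only:) (intro card_UN_disjoint, auto)
  also have "\<dots> = (\<Sum>J\<in>?S. card (Ad_sub_level H \<Pi> J 0))"
    using card_Ad_sub_level_zero by (intro sum.cong) auto
  finally show ?thesis .
qed

text \<open>The expansion of a product of factors 1 - 1 over A.\<close>

lemma sum_Pow_alternating:
  "finite A \<Longrightarrow> (\<Sum>S\<in>Pow A. (- 1) ^ card S) = (if A = {} then 1 else 0 :: int)"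
  using prod_diff_conv_sum[of A "\<lambda>_. 1 :: int" "\<lambda>_. 1"] by (auto simp: power_0_left)

text \<open>Inclusion-exclusion with S = \<Pi> - J: after exchanging the sums, each ideal I is
  weighted by the alternating sum over the subsets of I \<inter> \<Pi>, which is 1 if that set is
  empty and 0 otherwise.\<close>

lemma card_Ad_level_zero:
  "int (card (Ad_g_level H \<Pi> 0)) =
    (\<Sum>J\<in>Pow \<Pi>. (- 1) ^ (card \<Pi> - card J) * int (card (Ad_sub H \<Pi> J)))"
proof -
  let ?A = "Ad_g H \<Pi>"
  have "(\<Sum>J\<in>Pow \<Pi>. (- 1) ^ (card \<Pi> - card J) * int (card (Ad_sub H \<Pi> J))) =
      (\<Sum>S\<in>Pow \<Pi>. (- 1) ^ card S * int (card {I \<in> ?A. S \<subseteq> I}))"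
  proof (rule sum.reindex_bij_witness[of _ "\<lambda>S. \<Pi> - S" "\<lambda>S. \<Pi> - S"])
    fix J assume "J \<in> Pow \<Pi>"
    then have "J \<subseteq> \<Pi>" "finite J"
      using finite_simple finite_subset by auto
    then show "(- 1) ^ card (\<Pi> - J) * int (card {I \<in> ?A. \<Pi> - J \<subseteq> I}) =
        (- 1) ^ (card \<Pi> - card J) * int (card (Ad_sub H \<Pi> J))"
      by (simp add: card_Ad_sub card_Diff_subset)
  qed (auto simp: double_diff)
  also have "\<dots> = (\<Sum>S\<in>Pow \<Pi>. \<Sum>I\<in>?A. if S \<subseteq> I then (- 1) ^ card S else 0)"
    using finite_Ad by (simp add: sum.If_cases Int_def mult.commute)
  also have "\<dots> = (\<Sum>I\<in>?A. \<Sum>S\<in>Pow \<Pi>. if S \<subseteq> I then (- 1) ^ card S else 0)"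
    by (rule sum.swap)
  also have "\<dots> = (\<Sum>I\<in>?A. \<Sum>S\<in>Pow (I \<inter> \<Pi>). (- 1) ^ card S)"
    using finite_simple
    by (intro sum.cong refl sum.mono_neutral_cong_right) auto
  also have "\<dots> = (\<Sum>I\<in>?A. if I \<inter> \<Pi> = {} then 1 else 0)"
    using finite_simple by (simp add: sum_Pow_alternating del: Pow_Int_eq)
  also have "\<dots> = int (card (Ad_g_level H \<Pi> 0))"
    using finite_Ad finite_simple
    by (simp add: sum.If_cases Ad_g_level_def Ad_level_def Ad_g_def Int_def)
  finally show ?thesis by simp
qed

end

theorem mainTheorem5:
  fixes scale :: "complex \<Rightarrow> 'g::ab_group_add \<Rightarrow> 'g"
    and br :: "'g \<Rightarrow> 'g \<Rightarrow> 'g"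
    and H :: "'g set"
    and \<Pi> :: "('g \<Rightarrow> complex) set"
    and p :: nat
  assumes "simple_lie_algebra scale br"
    and "lie_algebra.cartan_subalgebra scale br H"
    and "lie_algebra.simple_roots scale br H \<Pi>"
    and "p = vector_space.dim scale H"
  shows "int (card (lie_algebra.Ad_g_level scale br H \<Pi> 0)) =
           (\<Sum>J\<in>Pow \<Pi>. (- 1) ^ (p - card J) * int (card (lie_algebra.Ad_sub scale br H \<Pi> J)))
       \<and> (\<forall>i\<in>{0..p}. card (lie_algebra.Ad_g_level scale br H \<Pi> i) =
           (\<Sum>J\<in>{J. J \<subseteq> \<Pi> \<and> card J = p - i}. card (lie_algebra.Ad_sub_level scale br H \<Pi> J 0)))"
proof -
  interpret simple_lie_algebra scale br by (rule assms(1))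
  interpret based_simple_lie_algebra scale br H \<Pi>
    by unfold_locales (use assms in auto)
  have "p = card \<Pi>"
    using assms(4) card_simple by simp
  then show ?thesis
    using card_Ad_level_zero card_Ad_level by simp
qed

end
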